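(* The category $\mathbb{S}_{\to}$, with the elementwise sequential composition, sum and trace, identities $\{\mathrm{id}_m\}$ and swaps $\{\sigma_{m,n}\}$, is a traced symmetric monoidal category (with objects natural numbers and monoidal product given by addition on objects).
   Context: $\mathbb{S}^{\mathrm{MC}}_{\to}$: objects natural numbers; an arrow $f\colon m\to n$ assigns to each $(i,j)\in[m]\times[n]$ ($[k]=\{1,\dots,k\}$) a pair $(p_{i,j},r_{i,j})\in\mathbb R_{\ge0}^2$ with $\sum_jp_{i,j}\le1$ for each $i$ and $p_{i,j}=0\Rightarrow r_{i,j}=0$. Composition of $f\colon m\to l$, $g\colon l\to n$: $P^{f;g}=P^fP^g$, $R^{f;g}=P^fR^g+R^fP^g$ with $P^f=[p^f_{i,k}]$, $R^f=[r^f_{i,k}]$. Sum $f\oplus g$: block-diagonal, $(0,0)$ off the blocks. Identity $\mathrm{id}_m(i,j)=(\delta_{ij},0)$; swap $\sigma_{m,n}\colon m+n\to n+m$ has $(1,0)$ at $(i,i+n)$ for $i\le m$ and at $(i,i-m)$ for $i>m$, $(0,0)$ elsewhere. Trace of $h\colon l+m\to l+n$: $p^{\mathrm{tr}^l_{m,n}(h)}_{i,j}=p^h_{l+i,l+j}+\sum_{d\in\mathbb N}(A_pB_p^dC_p)_{i,j}$ and $r^{\mathrm{tr}^l_{m,n}(h)}_{i,j}=r^h_{l+i,l+j}+\sum_d(AB^dC)_{i,j}$ with $A_p=[p^h_{l+i,k}]_{i\in[m],k\in[l]}$, $B_p=[p^h_{k,k'}]_{k,k'\in[l]}$, $C_p=[p^h_{k',l+j}]_{k'\in[l],j\in[n]}$,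 $A_r,B_r,C_r$ likewise with $r^h$, $A=(A_p\ A_r)$, $B=\begin{pmatrix}B_p&B_r\\0&B_p\end{pmatrix}$, $C=\begin{pmatrix}C_r\\C_p\end{pmatrix}$. $\mathbb{S}_{\to}$: objects natural numbers; an arrow $F\colon m\to n$ is a set of arrows $m\to n$ of $\mathbb{S}^{\mathrm{MC}}_{\to}$. Operations are elementwise: $F;G=\{f;g\mid f\in F,g\in G\}$, $F\oplus G=\{f\oplus g\mid f\in F,g\in G\}$, $\mathrm{tr}^l_{m,n}(H)=\{\mathrm{tr}^l_{m,n}(h)\mid h\in H\}$; identities $\{\mathrm{id}_m\}$ and swaps $\{\sigma_{m,n}\}$. *)

theory Defs
  imports Complex_Main "Jordan_Normal_Form.Matrix"
begin

section \<open>Strict traced symmetric monoidal categories\<close>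

text \<open>
  Categories are presented by families of hom-sets, which need not be disjoint; hence every
  operation on arrows carries its objects as explicit arguments.
  \<open>Comp m l n f g\<close> is the composite in diagrammatic order of \<open>f : m \<rightarrow> l\<close> and \<open>g : l \<rightarrow> n\<close>.
\<close>

locale hom_category =
  fixes Hom :: "'o \<Rightarrow> 'o \<Rightarrow> 'a set"
    and Id :: "'o \<Rightarrow> 'a"
    and Comp :: "'o \<Rightarrow> 'o \<Rightarrow> 'o \<Rightarrow> 'a \<Rightarrow> 'a \<Rightarrow> 'a"
  assumes Id_hom: "Id m \<in> Hom m m"
    and Comp_hom: "f \<in> Hom m l \<Longrightarrow> g \<in> Hom l n \<Longrightarrow> Comp m l n f g \<in> Hom m n"
    and Comp_Id_left: "f \<in> Hom m n \<Longrightarrow> Comp m m n (Id m) f = f"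
    and Comp_Id_right: "f \<in> Hom m n \<Longrightarrow> Comp m n n f (Id n) = f"
    and Comp_assoc: "f \<in> Hom m k \<Longrightarrow> g \<in> Hom k l \<Longrightarrow> h \<in> Hom l n \<Longrightarrow>
      Comp m l n (Comp m k l f g) h = Comp m k n f (Comp k l n g h)"

text \<open>
  The monoidal product on objects is the (strictly associative and unital) addition of the object
  type. \<open>Tens m n m' n' f f'\<close> is the product of \<open>f : m \<rightarrow> n\<close> and \<open>f' : m' \<rightarrow> n'\<close>.
\<close>

locale strict_monoidal_category = hom_category Hom Id Comp
  for Hom :: "'o::monoid_add \<Rightarrow> 'o \<Rightarrow> 'a set"
    and Id :: "'o \<Rightarrow> 'a"
    and Comp :: "'o \<Rightarrow> 'o \<Rightarrow> 'o \<Rightarrow> 'a \<Rightarrow> 'a \<Rightarrow> 'a" +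
  fixes Tens :: "'o \<Rightarrow> 'o \<Rightarrow> 'o \<Rightarrow> 'o \<Rightarrow> 'a \<Rightarrow> 'a \<Rightarrow> 'a"
  assumes Tens_hom: "f \<in> Hom m n \<Longrightarrow> f' \<in> Hom m' n' \<Longrightarrow>
      Tens m n m' n' f f' \<in> Hom (m + m') (n + n')"
    and Tens_Id: "Tens m m n n (Id m) (Id n) = Id (m + n)"
    and Tens_Comp: "f \<in> Hom m l \<Longrightarrow> g \<in> Hom l n \<Longrightarrow> f' \<in> Hom m' l' \<Longrightarrow> g' \<in> Hom l' n' \<Longrightarrow>
      Tens m n m' n' (Comp m l n f g) (Comp m' l' n' f' g') =
      Comp (m + m') (l + l') (n + n') (Tens m l m' l' f f') (Tens l n l' n' g g')"
    and Tens_assoc: "f \<in> Hom m n \<Longrightarrow> f' \<in> Hom m' n' \<Longrightarrow> f'' \<in> Hom m'' n'' \<Longrightarrow>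
      Tens (m + m') (n + n') m'' n'' (Tens m n m' n' f f') f'' =
      Tens m n (m' + m'') (n' + n'') f (Tens m' n' m'' n'' f' f'')"
    and Tens_unit_left: "f \<in> Hom m n \<Longrightarrow> Tens 0 0 m n (Id 0) f = f"
    and Tens_unit_right: "f \<in> Hom m n \<Longrightarrow> Tens m n 0 0 f (Id 0) = f"

locale strict_symmetric_monoidal_category = strict_monoidal_category Hom Id Comp Tens
  for Hom :: "'o::monoid_add \<Rightarrow> 'o \<Rightarrow> 'a set"
    and Id :: "'o \<Rightarrow> 'a"
    and Comp :: "'o \<Rightarrow> 'o \<Rightarrow> 'o \<Rightarrow> 'a \<Rightarrow> 'a \<Rightarrow> 'a"
    and Tens :: "'o \<Rightarrow> 'o \<Rightarrow> 'o \<Rightarrow> 'o \<Rightarrow> 'a \<Rightarrow> 'a \<Rightarrow> 'a" +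
  fixes Swap :: "'o \<Rightarrow> 'o \<Rightarrow> 'a"
  assumes Swap_hom: "Swap m n \<in> Hom (m + n) (n + m)"
    and Swap_natural: "f \<in> Hom m n \<Longrightarrow> f' \<in> Hom m' n' \<Longrightarrow>
      Comp (m + m') (n + n') (n' + n) (Tens m n m' n' f f') (Swap n n') =
      Comp (m + m') (m' + m) (n' + n) (Swap m m') (Tens m' n' m n f' f)"
    and Swap_Swap: "Comp (m + n) (n + m) (m + n) (Swap m n) (Swap n m) = Id (m + n)"
    and Swap_hexagon: "Swap m (n + k) =
      Comp (m + n + k) (n + m + k) (n + k + m)
        (Tens (m + n) (n + m) k k (Swap m n) (Id k))
        (Tens n n (m + k) (k + m) (Id n) (Swap m k))"
    and Swap_unit: "Swap m 0 = Id m"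

text \<open>
  The traced object stands on the left: \<open>Tr l m n\<close> sends \<open>h : l + m \<rightarrow> l + n\<close> to an arrow \<open>m \<rightarrow> n\<close>.
\<close>

locale strict_traced_symmetric_monoidal_category =
  strict_symmetric_monoidal_category Hom Id Comp Tens Swap
  for Hom :: "'o::monoid_add \<Rightarrow> 'o \<Rightarrow> 'a set"
    and Id :: "'o \<Rightarrow> 'a"
    and Comp :: "'o \<Rightarrow> 'o \<Rightarrow> 'o \<Rightarrow> 'a \<Rightarrow> 'a \<Rightarrow> 'a"
    and Tens :: "'o \<Rightarrow> 'o \<Rightarrow> 'o \<Rightarrow> 'o \<Rightarrow> 'a \<Rightarrow> 'a \<Rightarrow> 'a"
    and Swap :: "'o \<Rightarrow> 'o \<Rightarrow> 'a" +
  fixes Tr :: "'o \<Rightarrow> 'o \<Rightarrow> 'o \<Rightarrow> 'a \<Rightarrow> 'a"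
  assumes Tr_hom: "h \<in> Hom (l + m) (l + n) \<Longrightarrow> Tr l m n h \<in> Hom m n"
    and Tr_natural_left: "f \<in> Hom m' m \<Longrightarrow> h \<in> Hom (l + m) (l + n) \<Longrightarrow>
      Tr l m' n (Comp (l + m') (l + m) (l + n) (Tens l l m' m (Id l) f) h) =
      Comp m' m n f (Tr l m n h)"
    and Tr_natural_right: "h \<in> Hom (l + m) (l + n) \<Longrightarrow> g \<in> Hom n n' \<Longrightarrow>
      Tr l m n' (Comp (l + m) (l + n) (l + n') h (Tens l l n n' (Id l) g)) =
      Comp m n n' (Tr l m n h) g"
    and Tr_dinatural: "h \<in> Hom (l + m) (l' + n) \<Longrightarrow> g \<in> Hom l' l \<Longrightarrow>
      Tr l m n (Comp (l + m) (l' + n) (l + n) h (Tens l' l n n g (Id n))) =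
      Tr l' m n (Comp (l' + m) (l + m) (l' + n) (Tens l' l m m g (Id m)) h)"
    and Tr_vanishing_unit: "h \<in> Hom m n \<Longrightarrow> Tr 0 m n h = h"
    and Tr_vanishing_plus: "h \<in> Hom (k + l + m) (k + l + n) \<Longrightarrow>
      Tr (k + l) m n h = Tr l m n (Tr k (l + m) (l + n) h)"
    and Tr_superposing: "h \<in> Hom (l + m) (l + n) \<Longrightarrow> g \<in> Hom m' n' \<Longrightarrow>
      Tr l (m + m') (n + n') (Tens (l + m) (l + n) m' n' h g) =
      Tens m n m' n' (Tr l m n h) g"
    and Tr_yanking: "Tr l l l (Swap l l) = Id l"


section \<open>The semantic category of Markov chains\<close>

text \<open>Matrix indices are 0-based, so \<open>[k]\<close> becomes \<open>{0..<k}\<close>; the entry at \<open>(i, j)\<close> is \<open>(p, r)\<close>.\<close>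

type_synonym mc_arrow = "(real \<times> real) mat"

definition mc_hom :: "nat \<Rightarrow> nat \<Rightarrow> mc_arrow set" where
  "mc_hom m n = {f \<in> carrier_mat m n.
     (\<forall>i<m. \<forall>j<n. 0 \<le> fst (f $$ (i, j)) \<and> 0 \<le> snd (f $$ (i, j))) \<and>
     (\<forall>i<m. (\<Sum>j<n. fst (f $$ (i, j))) \<le> 1) \<and>
     (\<forall>i<m. \<forall>j<n. fst (f $$ (i, j)) = 0 \<longrightarrow> snd (f $$ (i, j)) = 0)}"

definition prob_mat :: "mc_arrow \<Rightarrow> real mat" where
  "prob_mat f = map_mat fst f"

definition rew_mat :: "mc_arrow \<Rightarrow> real mat" where
  "rew_mat f = map_mat snd f"

definition mc_comp :: "mc_arrow \<Rightarrow> mc_arrow \<Rightarrow> mc_arrow" where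
  "mc_comp f g = mat (dim_row f) (dim_col g) (\<lambda>ij.
     ((prob_mat f * prob_mat g) $$ ij,
      (prob_mat f * rew_mat g + rew_mat f * prob_mat g) $$ ij))"

definition mc_sum :: "mc_arrow \<Rightarrow> mc_arrow \<Rightarrow> mc_arrow" where
  "mc_sum f g = four_block_mat
     f (mat (dim_row f) (dim_col g) (\<lambda>_. (0, 0)))
     (mat (dim_row g) (dim_col f) (\<lambda>_. (0, 0))) g"

definition mc_id :: "nat \<Rightarrow> mc_arrow" where
  "mc_id m = mat m m (\<lambda>(i, j). (if i = j then 1 else 0, 0))"

definition mc_swap :: "nat \<Rightarrow> nat \<Rightarrow> mc_arrow" where
  "mc_swap m n = mat (m + n) (n + m) (\<lambda>(i, j).
     if (i < m \<and> j = i + n) \<or> (m \<le> i \<and> j = i - m) then (1, 0) else (0, 0))"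

text \<open>
  The blocks \<open>A\<close>, \<open>B\<close>, \<open>C\<close> of a matrix with rows \<open>l + m\<close> and columns \<open>l + n\<close>, describing the
  entries into, within and out of the loop over the first \<open>l\<close> indices.
\<close>

definition entry_block :: "nat \<Rightarrow> nat \<Rightarrow> real mat \<Rightarrow> real mat" where
  "entry_block l m X = mat m l (\<lambda>(i, k). X $$ (l + i, k))"

definition loop_block :: "nat \<Rightarrow> real mat \<Rightarrow> real mat" where
  "loop_block l X = mat l l (\<lambda>(k, k'). X $$ (k, k'))"

definition exit_block :: "nat \<Rightarrow> nat \<Rightarrow> real mat \<Rightarrow> real mat" where
  "exit_block l n X = mat l n (\<lambda>(k, j). X $$ (k, l + j))"

text \<open>
  In \<open>A\<close>, the blocks with no rows only serve to place \<open>A\<^sub>p\<close> and \<open>A\<^sub>r\<close> side by side. The two series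
  converge for every \<open>h \<in> mc_hom (l + m) (l + n)\<close>: a loop state from which an exit is reachable is
  transient, and an entry with zero probability has zero reward.
\<close>

definition mc_trace :: "nat \<Rightarrow> nat \<Rightarrow> nat \<Rightarrow> mc_arrow \<Rightarrow> mc_arrow" where
  "mc_trace l m n h =
    (let P = prob_mat h; R = rew_mat h;
         A\<^sub>p = entry_block l m P; A\<^sub>r = entry_block l m R;
         B\<^sub>p = loop_block l P; B\<^sub>r = loop_block l R;
         C\<^sub>p = exit_block l n P; C\<^sub>r = exit_block l n R;
         A = four_block_mat A\<^sub>p A\<^sub>r (0\<^sub>m 0 l) (0\<^sub>m 0 l);
         B = four_block_mat B\<^sub>p B\<^sub>r (0\<^sub>m l l) B\<^sub>p;
         C = C\<^sub>r @\<^sub>r C\<^sub>p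
     in mat m n (\<lambda>(i, j).
          (P $$ (l + i, l + j) + (\<Sum>d. (A\<^sub>p * B\<^sub>p ^\<^sub>m d * C\<^sub>p) $$ (i, j)),
           R $$ (l + i, l + j) + (\<Sum>d. (A * B ^\<^sub>m d * C) $$ (i, j)))))"


section \<open>The semantic category of Markov decision processes\<close>

type_synonym mdp_arrow = "mc_arrow set"

definition mdp_hom :: "nat \<Rightarrow> nat \<Rightarrow> mdp_arrow set" where
  "mdp_hom m n = {F. F \<subseteq> mc_hom m n}"

definition mdp_id :: "nat \<Rightarrow> mdp_arrow" where
  "mdp_id m = {mc_id m}"

definition mdp_comp :: "mdp_arrow \<Rightarrow> mdp_arrow \<Rightarrow> mdp_arrow" where
  "mdp_comp F G = {mc_comp f g | f g. f \<in> F \<and> g \<in> G}"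

definition mdp_sum :: "mdp_arrow \<Rightarrow> mdp_arrow \<Rightarrow> mdp_arrow" where
  "mdp_sum F G = {mc_sum f g | f g. f \<in> F \<and> g \<in> G}"

definition mdp_swap :: "nat \<Rightarrow> nat \<Rightarrow> mdp_arrow" where
  "mdp_swap m n = {mc_swap m n}"

definition mdp_trace :: "nat \<Rightarrow> nat \<Rightarrow> nat \<Rightarrow> mdp_arrow \<Rightarrow> mdp_arrow" where
  "mdp_trace l m n H = {mc_trace l m n h | h. h \<in> H}"

end

theory Submission
  imports Defs "HOL-Library.Extended_Nonnegative_Real" "HOL-Library.Product_Order"
begin

text \<open>
  An arrow \<open>f : m \<rightarrow> n\<close> acts on vectors of pairs of extended nonnegative reals by
  \<open>(x, y) \<mapsto> (P x, P y + R x)\<close>. This action is faithful, turns composition into composition of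
  monotone maps and \<open>\<oplus>\<close> into the pairing of blocks. The trace becomes the least fixed point operator:
  the series in its definition is the Kleene iteration of \<open>x \<mapsto> h (x, y)\<close>. The trace axioms are
  then the rolling and diagonal (Bekic) identities for least fixed points. It remains to see that
  the fixed points are finite. Exit probabilities are bounded by 1; for the rewards, which are
  dominated by a multiple of the probabilities, a finite pre-fixed point is built from the
  tails of the exit probabilities. Every axiom uses each of its arrows exactly once on either side,
  so the axioms lift elementwise to sets of arrows.
\<close>

hide_const (open) Order.top

section \<open>A trace on monotone functions\<close>

text \<open>Vectors are total functions, so only the length \<open>l\<close> of the left part is
  recorded; whatever \<open>x\<close> holds from \<open>l\<close> on is ignored.\<close>

definition vjoin :: "nat \<Rightarrow> (nat \<Rightarrow> 'b) \<Rightarrow> (nat \<Rightarrow> 'b) \<Rightarrow> nat \<Rightarrow> 'b" where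
  "vjoin l x y = (\<lambda>i. if i < l then x i else y (i - l))"

definition vdrop :: "nat \<Rightarrow> (nat \<Rightarrow> 'b) \<Rightarrow> nat \<Rightarrow> 'b" where
  "vdrop l x = (\<lambda>i. x (l + i))"

text \<open>The fixed point ranges over whole output vectors of \<open>F\<close>, although only
  their first \<open>l\<close> entries are fed back. So \<open>F\<close> is never cut into blocks
  and the fixed-point rules apply to it as it stands.\<close>

definition ftrace :: "nat \<Rightarrow> ((nat \<Rightarrow> 'b::complete_lattice) \<Rightarrow> nat \<Rightarrow> 'b) \<Rightarrow> (nat \<Rightarrow> 'b) \<Rightarrow> nat \<Rightarrow> 'b" where
  "ftrace l F y = vdrop l (lfp (\<lambda>x. F (vjoin l x y)))"

lemma vdrop_vjoin [simp]: "vdrop l (vjoin l x y) = y"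
  by (auto simp: vdrop_def vjoin_def)

lemma vjoin_0 [simp]: "vjoin 0 x y = y" and vdrop_0 [simp]: "vdrop 0 x = x"
  by (auto simp: vdrop_def vjoin_def)

lemma vjoin_vjoin_left [simp]: "vjoin l (vjoin l x z) y = vjoin l x y"
  by (auto simp: vjoin_def)

lemma vjoin_vdrop [simp]: "vjoin l x (vdrop l x) = x"
  by (auto simp: vdrop_def vjoin_def)

lemma vjoin_vjoin_right: "vjoin k x (vjoin l z y) = vjoin (k + l) (vjoin k x z) y"
  by (auto simp: vjoin_def fun_eq_iff)

lemma vdrop_vdrop: "vdrop l (vdrop k x) = vdrop (k + l) x"
  by (auto simp: vdrop_def add.assoc)

lemma vjoin_mono: "x \<le> x' \<Longrightarrow> y \<le> y' \<Longrightarrow> vjoin l x y \<le> vjoin l x' y'"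
  for x :: "nat \<Rightarrow> 'b::order"
  by (auto simp: vjoin_def le_fun_def)

lemma vdrop_mono: "x \<le> x' \<Longrightarrow> vdrop l x \<le> vdrop l x'"
  for x :: "nat \<Rightarrow> 'b::order"
  by (auto simp: vdrop_def le_fun_def)

section \<open>Trace axioms as identities between least fixed points\<close>

text \<open>The rolling rule moves the map \<open>?K\<close>, which inserts \<open>g\<close> into
  the feedback, from one side of \<open>H\<close> to the other. The third assumption says that
  \<open>g\<close> reads loop entries only, so the parameter \<open>y\<close> does not reach
  it.\<close>

lemma ftrace_dinatural:
  assumes "mono H" "mono g" and g: "\<And>x y. g (vjoin l x y) = g x"
  shows "ftrace l (\<lambda>v. H (vjoin l' (g v) (vdrop l v))) =
    ftrace l' (\<lambda>v. vjoin l' (g (H v)) (vdrop l (H v)))"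
proof
  fix y
  let ?K = "\<lambda>v. vjoin l' (g v) (vdrop l v)"
  have "?K (lfp (\<lambda>x. H (vjoin l' (?K x) y))) = lfp (\<lambda>x. ?K (H (vjoin l' x y)))"
    by (rule lfp_rolling[of ?K "\<lambda>x. H (vjoin l' x y)"])
      (auto intro!: monoI vjoin_mono vdrop_mono monoD[OF assms(1)] monoD[OF assms(2)])
  from arg_cong[OF this, of "vdrop l'"]
  have "vdrop l' (lfp (\<lambda>x. ?K (H (vjoin l' x y)))) = vdrop l (lfp (\<lambda>x. H (vjoin l' (g x) y)))"
    by (simp only: vdrop_vjoin vjoin_vjoin_left)
  then show "ftrace l (\<lambda>v. H (?K v)) y = ftrace l' (\<lambda>v. ?K (H v)) y"
    by (simp add: ftrace_def g)
qed

text \<open>Rolling again, with a \<open>?K\<close> that changes only entries past \<open>l\<close>: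
  the feedback does not see it, so the loop is that of \<open>H\<close> and \<open>f\<close> is
  applied once to the result.\<close>

lemma ftrace_natural_left:
  assumes "mono H" "mono f"
  shows "ftrace l (\<lambda>v. vjoin l (H v) (f (vdrop l (H v)))) y = f (ftrace l H y)"
proof -
  let ?K = "\<lambda>v. vjoin l v (f (vdrop l v))"
  have "?K (lfp (\<lambda>x. H (vjoin l (?K x) y))) = lfp (\<lambda>x. ?K (H (vjoin l x y)))"
    by (rule lfp_rolling[of ?K "\<lambda>x. H (vjoin l x y)"])
      (auto intro!: monoI vjoin_mono vdrop_mono monoD[OF assms(1)] monoD[OF assms(2)])
  from arg_cong[OF this, of "vdrop l"] show ?thesis
    by (simp only: ftrace_def vdrop_vjoin vjoin_vjoin_left)
qed

lemma ftrace_natural_right: "ftrace l (\<lambda>v. H (vjoin l v (g (vdrop l v)))) y = ftrace l H (g y)"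
  by (simp add: ftrace_def)

lemma ftrace_0: "ftrace 0 H = H"
  by (simp add: ftrace_def fun_eq_iff lfp_const)

text \<open>Bekic's identity: solving \<open>k + l\<close> equations at once agrees with solving the
  first \<open>k\<close> with the others as parameters, and then the remaining
  \<open>l\<close>.\<close>

lemma ftrace_plus:
  assumes "mono H"
  shows "ftrace (k + l) H = ftrace l (ftrace k H)"
proof
  fix y
  let ?G = "\<lambda>w. H (vjoin (k + l) w y)"
  \<comment> \<open>\<open>?S z\<close> solves the inner loop of length \<open>k\<close> while the
    entries from \<open>k\<close> on are held at \<open>z\<close>.\<close>
  let ?S = "\<lambda>z. lfp (\<lambda>x. ?G (vjoin k x z))"
  have G: "?G x \<le> ?G x'" if "x \<le> x'" for x x'
    using that by (intro monoD[OF assms] vjoin_mono) auto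
  \<comment> \<open>The outer loop may be solved over whole vectors \<open>w\<close>, of which only
    \<open>vdrop k w\<close> matters, or over these tails directly.\<close>
  have roll: "vdrop k (lfp (\<lambda>w. ?S (vdrop k w))) = lfp (\<lambda>z. vdrop k (?S z))"
    by (rule lfp_rolling[of "vdrop k" ?S]) (auto intro!: monoI vdrop_mono lfp_mono G vjoin_mono)
  \<comment> \<open>Diagonal rule: the nested fixed points merge. Since
    \<open>vjoin k w (vdrop k w)\<close> is \<open>w\<close>, what is left is the simultaneous loop
    of \<open>?G\<close>.\<close>
  have "lfp (\<lambda>w. ?S (vdrop k w)) = lfp (\<lambda>w. ?G (vjoin k w (vdrop k w)))"
    by (rule lfp_lfp[of "\<lambda>w x. ?G (vjoin k x (vdrop k w))"]) (auto intro!: G vjoin_mono vdrop_mono)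
  from roll[unfolded this] show "ftrace (k + l) H y = ftrace l (ftrace k H) y"
    by (simp only: ftrace_def vjoin_vjoin_right vjoin_vdrop vdrop_vdrop[symmetric])
qed

text \<open>\<open>g\<close> reads only entries that come from \<open>y\<close>, so its value
  \<open>?c\<close> is constant during the iteration and rolling takes it out of the fixed
  point.\<close>

lemma ftrace_superposing:
  assumes "mono H"
  shows "ftrace l (\<lambda>v. vjoin (l + m) (H v) (g (vdrop (l + n) v))) y =
    vjoin m (ftrace l H y) (g (vdrop n y))"
proof -
  let ?c = "g (vdrop n y)"
  let ?K = "\<lambda>v. vjoin (l + m) v ?c"
  have roll: "?K (lfp (\<lambda>x. H (vjoin l (?K x) y))) = lfp (\<lambda>x. ?K (H (vjoin l x y)))"
    by (rule lfp_rolling[of ?K "\<lambda>x. H (vjoin l x y)"])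
      (auto intro!: monoI vjoin_mono monoD[OF assms(1)])
  have "vjoin l (?K x) y = vjoin l x y" for x
    by (auto simp: vjoin_def fun_eq_iff)
  moreover have "vdrop l (?K x) = vjoin m (vdrop l x) ?c" for x
    by (auto simp: vjoin_def vdrop_def fun_eq_iff)
  moreover have "vdrop (l + n) (vjoin l x y) = vdrop n y" for x
    by (simp flip: vdrop_vdrop)
  ultimately show ?thesis
    using arg_cong[OF roll, of "vdrop l"] by (simp only: ftrace_def)
qed

lemma ftrace_yanking:
  "ftrace l (\<lambda>v. vjoin l (vdrop l v) (vjoin l v bot)) y = vjoin l y bot"
proof -
  let ?F = "\<lambda>x. vjoin l y (vjoin l x bot)"
  have "lfp ?F = ?F (lfp ?F)"
    by (rule lfp_unfold) (auto intro!: monoI vjoin_mono)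
  \<comment> \<open>The inner unfolding puts \<open>y\<close> into the loop entries, the outer one
    copies them to the entries past \<open>l\<close>. Any fixed point would give the same
    result.\<close>
  then have "lfp ?F = ?F (?F (lfp ?F))"
    by metis
  from arg_cong[OF this, of "vdrop l"] show ?thesis
    by (simp only: ftrace_def vdrop_vjoin vjoin_vjoin_left)
qed

section \<open>Arrows as linear maps on extended nonnegative values\<close>

type_synonym val = "ennreal \<times> ennreal"

section \<open>The faithful action of arrows on vectors\<close>

text \<open>Writing a pair as \<open>x + eps y\<close> with \<open>eps^2 = 0\<close>, this is
  multiplication by the matrix \<open>P + eps R\<close>. It runs backwards, from values at the exits
  to values at the entries. Rows out of range give \<open>bot\<close>, which is zero.\<close>

definition mc_act :: "mc_arrow \<Rightarrow> (nat \<Rightarrow> val) \<Rightarrow> nat \<Rightarrow> val" where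
  "mc_act f v i = (if i < dim_row f then
     (\<Sum>j<dim_col f. ennreal (fst (f $$ (i, j))) * fst (v j),
      \<Sum>j<dim_col f. ennreal (fst (f $$ (i, j))) * snd (v j) + ennreal (snd (f $$ (i, j))) * fst (v j))
     else bot)"

lemma bot_val: "(bot :: val) = (0, 0)"
  by (simp add: bot_prod_def bot_ennreal)

lemma mc_homD:
  assumes "f \<in> mc_hom m n"
  shows "dim_row f = m" "dim_col f = n"
    and "\<And>i j. i < m \<Longrightarrow> j < n \<Longrightarrow> 0 \<le> fst (f $$ (i, j))"
    and "\<And>i j. i < m \<Longrightarrow> j < n \<Longrightarrow> 0 \<le> snd (f $$ (i, j))"
    and "\<And>i. i < m \<Longrightarrow> (\<Sum>j<n. fst (f $$ (i, j))) \<le> 1"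
    and "\<And>i j. i < m \<Longrightarrow> j < n \<Longrightarrow> fst (f $$ (i, j)) = 0 \<Longrightarrow> snd (f $$ (i, j)) = 0"
  using assms by (auto simp: mc_hom_def)

lemma mc_homI:
  assumes "dim_row f = m" "dim_col f = n"
    and "\<And>i j. i < m \<Longrightarrow> j < n \<Longrightarrow> 0 \<le> fst (f $$ (i, j))"
    and "\<And>i j. i < m \<Longrightarrow> j < n \<Longrightarrow> 0 \<le> snd (f $$ (i, j))"
    and "\<And>i. i < m \<Longrightarrow> (\<Sum>j<n. fst (f $$ (i, j))) \<le> 1"
    and "\<And>i j. i < m \<Longrightarrow> j < n \<Longrightarrow> fst (f $$ (i, j)) = 0 \<Longrightarrow> snd (f $$ (i, j)) = 0"
  shows "f \<in> mc_hom m n"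
  using assms by (auto simp: mc_hom_def)

lemma mc_act_mono: "mono (mc_act f)"
  by (auto intro!: monoI sum_mono add_mono mult_left_mono
      simp: mc_act_def le_fun_def less_eq_prod_def)

lemma mc_act_cong: "(\<And>j. j < dim_col f \<Longrightarrow> v j = w j) \<Longrightarrow> mc_act f v = mc_act f w"
  by (auto simp: mc_act_def fun_eq_iff)

lemma mc_act_vjoin [simp]: "dim_col f \<le> n \<Longrightarrow> mc_act f (vjoin n v w) = mc_act f v"
  by (rule mc_act_cong) (auto simp: vjoin_def)

lemma mc_act_vjoin_bot [simp]: "dim_row f \<le> m \<Longrightarrow> vjoin m (mc_act f v) bot = mc_act f v"
  by (auto simp: vjoin_def mc_act_def)

text \<open>The unit vector at \<open>j\<close> with reward part 0 is sent to column
  \<open>j\<close> of \<open>P\<close> paired with column \<open>j\<close> of \<open>R\<close>.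
  Entries can be recovered from \<open>ennreal\<close> because they are nonnegative.\<close>

lemma mc_act_inj:
  assumes f: "f \<in> mc_hom m n" and g: "g \<in> mc_hom m n" and eq: "mc_act f = mc_act g"
  shows "f = g"
proof (rule eq_matI)
  fix i j assume ij: "i < dim_row g" "j < dim_col g"
  note hf = mc_homD[OF f] and hg = mc_homD[OF g]
  define e :: "nat \<Rightarrow> val" where "e = (\<lambda>k. (if k = j then 1 else 0, 0))"
  have e_simps: "a * fst (e k) = (if k = j then a else 0)" "snd (e k) = 0" for k a
    by (auto simp: e_def)
  have e: "mc_act h e i = (ennreal (fst (h $$ (i, j))), ennreal (snd (h $$ (i, j))))"
    if "h \<in> mc_hom m n" for h
    using ij mc_homD(1,2)[OF that] hg(1,2) by (simp add: mc_act_def e_simps)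
  show "f $$ (i, j) = g $$ (i, j)"
    using e[OF f] e[OF g] eq ij hf hg by (simp add: prod_eq_iff)
qed (use mc_homD[OF f] mc_homD[OF g] in auto)

lemma mc_comp_index:
  assumes "dim_col f = dim_row g" "i < dim_row f" "j < dim_col g"
  shows "fst (mc_comp f g $$ (i, j)) = (\<Sum>k<dim_row g. fst (f $$ (i, k)) * fst (g $$ (k, j)))"
    and "snd (mc_comp f g $$ (i, j)) =
      (\<Sum>k<dim_row g. fst (f $$ (i, k)) * snd (g $$ (k, j)) + snd (f $$ (i, k)) * fst (g $$ (k, j)))"
  using assms
  by (auto simp: mc_comp_def prob_mat_def rew_mat_def scalar_prod_def sum.distrib atLeast0LessThan
      intro!: sum.cong)

lemma mc_comp_dim [simp]: "dim_row (mc_comp f g) = dim_row f" "dim_col (mc_comp f g) = dim_col g"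
  by (auto simp: mc_comp_def)

lemma mc_comp_hom:
  assumes f: "f \<in> mc_hom m l" and g: "g \<in> mc_hom l n"
  shows "mc_comp f g \<in> mc_hom m n"
proof -
  note F = mc_homD[OF f] and G = mc_homD[OF g]
  have p: "fst (mc_comp f g $$ (i, j)) = (\<Sum>k<l. fst (f $$ (i, k)) * fst (g $$ (k, j)))"
    and r: "snd (mc_comp f g $$ (i, j)) =
      (\<Sum>k<l. fst (f $$ (i, k)) * snd (g $$ (k, j)) + snd (f $$ (i, k)) * fst (g $$ (k, j)))"
    if "i < m" "j < n" for i j
    using mc_comp_index[of f g i j] that F G by auto
  show ?thesis
  proof (rule mc_homI)
    fix i assume i: "i < m"
    show "(\<Sum>j<n. fst (mc_comp f g $$ (i, j))) \<le> 1"
    proof -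
      have "(\<Sum>j<n. fst (mc_comp f g $$ (i, j))) = (\<Sum>k<l. fst (f $$ (i, k)) * (\<Sum>j<n. fst (g $$ (k, j))))"
        using i by (simp add: p sum_distrib_left) (rule sum.swap)
      also have "\<dots> \<le> (\<Sum>k<l. fst (f $$ (i, k)) * 1)"
        using i F G by (intro sum_mono mult_left_mono) auto
      also have "\<dots> \<le> 1"
        using F(5)[OF i] by simp
      finally show ?thesis .
    qed
  next
    fix i j assume ij: "i < m" "j < n"
    show "0 \<le> fst (mc_comp f g $$ (i, j))" "0 \<le> snd (mc_comp f g $$ (i, j))"
      using ij F G by (auto simp: p r intro!: sum_nonneg add_nonneg_nonneg mult_nonneg_nonneg)
    assume 0: "fst (mc_comp f g $$ (i, j)) = 0"
    \<comment> \<open>A sum of nonnegative terms is 0 only if each term is. Then one of the two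
      factors has probability 0, hence reward 0, and both products in the reward term
      vanish.\<close>
    have "\<forall>k<l. fst (f $$ (i, k)) * fst (g $$ (k, j)) = 0"
      using 0 sum_nonneg_eq_0_iff[of "{..<l}" "\<lambda>k. fst (f $$ (i, k)) * fst (g $$ (k, j))"] F(3) G(3) ij
      by (simp add: p)
    then show "snd (mc_comp f g $$ (i, j)) = 0"
      using ij F(6) G(6) by (auto simp: r intro!: sum.neutral)
  qed (simp_all add: F G)
qed

text \<open>An exchange of finite sums. As \<open>ennreal\<close> truncates negative numbers, moving
  it through sums and products relies on the nonnegativity of all entries.\<close>

lemma mc_act_comp:
  assumes f: "f \<in> mc_hom m l" and g: "g \<in> mc_hom l n"
  shows "mc_act (mc_comp f g) v = mc_act f (mc_act g v)"
proof
  fix i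
  note F = mc_homD[OF f] and G = mc_homD[OF g]
  show "mc_act (mc_comp f g) v i = mc_act f (mc_act g v) i"
  proof (cases "i < m")
    case True
    let ?pf = "\<lambda>k. ennreal (fst (f $$ (i, k)))" and ?rf = "\<lambda>k. ennreal (snd (f $$ (i, k)))"
    let ?pg = "\<lambda>k j. ennreal (fst (g $$ (k, j)))" and ?rg = "\<lambda>k j. ennreal (snd (g $$ (k, j)))"
    have p: "ennreal (fst (mc_comp f g $$ (i, j))) = (\<Sum>k<l. ?pf k * ?pg k j)"
      and r: "ennreal (snd (mc_comp f g $$ (i, j))) = (\<Sum>k<l. ?pf k * ?rg k j + ?rf k * ?pg k j)"
      if "j < n" for j
    proof -
      have nonneg: "0 \<le> fst (f $$ (i, k))" "0 \<le> snd (f $$ (i, k))" "0 \<le> fst (g $$ (k, j))"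
        "0 \<le> snd (g $$ (k, j))" if "k < l" for k
        using that \<open>j < n\<close> True F G by auto
      have "(\<Sum>k<l. ?pf k * ?pg k j) = (\<Sum>k<l. ennreal (fst (f $$ (i, k)) * fst (g $$ (k, j))))"
        by (rule sum.cong) (auto simp: ennreal_mult nonneg)
      also have "\<dots> = ennreal (\<Sum>k<l. fst (f $$ (i, k)) * fst (g $$ (k, j)))"
        by (rule sum_ennreal) (simp add: nonneg)
      finally show "ennreal (fst (mc_comp f g $$ (i, j))) = (\<Sum>k<l. ?pf k * ?pg k j)"
        using mc_comp_index(1)[of f g i j] that F(1,2) G(1,2) True by simp
      have "(\<Sum>k<l. ?pf k * ?rg k j + ?rf k * ?pg k j) =
        (\<Sum>k<l. ennreal (fst (f $$ (i, k)) * snd (g $$ (k, j)) + snd (f $$ (i, k)) * fst (g $$ (k, j))))"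
        by (rule sum.cong) (auto simp: ennreal_mult ennreal_plus nonneg)
      also have "\<dots> = ennreal (\<Sum>k<l. fst (f $$ (i, k)) * snd (g $$ (k, j)) + snd (f $$ (i, k)) * fst (g $$ (k, j)))"
        by (rule sum_ennreal) (simp add: nonneg)
      finally show "ennreal (snd (mc_comp f g $$ (i, j))) = (\<Sum>k<l. ?pf k * ?rg k j + ?rf k * ?pg k j)"
        using mc_comp_index(2)[of f g i j] that F(1,2) G(1,2) True by simp
    qed
    have "(\<Sum>j<n. (\<Sum>k<l. ?pf k * ?pg k j) * fst (v j)) = (\<Sum>k<l. ?pf k * (\<Sum>j<n. ?pg k j * fst (v j)))"
      unfolding sum_distrib_left sum_distrib_right mult.assoc by (rule sum.swap)
    moreover have "(\<Sum>j<n. (\<Sum>k<l. ?pf k * ?pg k j) * snd (v j) + (\<Sum>k<l. ?pf k * ?rg k j + ?rf k * ?pg k j) * fst (v j))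
      = (\<Sum>k<l. ?pf k * (\<Sum>j<n. ?pg k j * snd (v j) + ?rg k j * fst (v j)) + ?rf k * (\<Sum>j<n. ?pg k j * fst (v j)))"
      (is "?L = ?R")
    proof -
      have "?L = (\<Sum>j<n. \<Sum>k<l. ?pf k * ?pg k j * snd (v j) + ?pf k * ?rg k j * fst (v j) + ?rf k * ?pg k j * fst (v j))"
        unfolding sum_distrib_right sum.distrib distrib_right by (simp only: add.assoc)
      also have "\<dots> = (\<Sum>k<l. \<Sum>j<n. ?pf k * ?pg k j * snd (v j) + ?pf k * ?rg k j * fst (v j) + ?rf k * ?pg k j * fst (v j))"
        by (rule sum.swap)
      also have "\<dots> = ?R"
        unfolding sum_distrib_left sum.distrib distrib_left by (simp only: mult.assoc)
      finally show ?thesis .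
    qed
    ultimately show ?thesis
      using True F(1,2) G(1,2) by (simp add: mc_act_def p r del: sum_ennreal)
  qed (simp add: mc_act_def F)
qed

section \<open>Actions of identities, swaps and sums\<close>

lemma ennreal_indicator_mult: "ennreal (if b then 1 else 0) * x = (if b then x else 0)"
  by simp

lemma mc_id_dim [simp]: "dim_row (mc_id m) = m" "dim_col (mc_id m) = m"
  by (auto simp: mc_id_def)

lemma mc_id_index: "i < m \<Longrightarrow> j < m \<Longrightarrow> mc_id m $$ (i, j) = (if i = j then 1 else 0, 0)"
  by (simp add: mc_id_def)

lemma mc_id_hom: "mc_id m \<in> mc_hom m m"
  by (rule mc_homI) (auto simp: mc_id_index)

text \<open>Not the identity map but truncation to \<open>m\<close> entries. It disappears before an
  action with at most \<open>m\<close> columns and after one with at most \<open>m\<close>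
  rows.\<close>

lemma mc_act_id: "mc_act (mc_id m) v = vjoin m v bot"
proof
  show "mc_act (mc_id m) v i = vjoin m v bot i" for i
    by (cases "i < m") (simp_all add: mc_act_def vjoin_def mc_id_index ennreal_indicator_mult)
qed

lemma mc_swap_dim [simp]: "dim_row (mc_swap m n) = m + n" "dim_col (mc_swap m n) = n + m"
  by (auto simp: mc_swap_def)

lemma mc_swap_index:
  assumes "i < m + n" "j < n + m"
  shows "mc_swap m n $$ (i, j) = (if j = (if i < m then i + n else i - m) then 1 else 0, 0)"
  using assms by (simp add: mc_swap_def)

lemma mc_swap_hom: "mc_swap m n \<in> mc_hom (m + n) (n + m)"
  by (rule mc_homI) (auto simp: mc_swap_index)

lemma mc_act_swap: "mc_act (mc_swap m n) v = vjoin m (vdrop n v) (vjoin n v bot)"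
proof
  fix i
  \<comment> \<open>\<open>k\<close> is the only column of row \<open>i\<close> that holds a
    1.\<close>
  define k where "k = (if i < m then i + n else i - m)"
  have "mc_act (mc_swap m n) v i = v k" if "i < m + n"
  proof -
    have "k < n + m"
      using that by (auto simp: k_def)
    then show ?thesis
      using that
      by (simp add: mc_act_def mc_swap_index flip: k_def) (simp add: ennreal_indicator_mult)
  qed
  then show "mc_act (mc_swap m n) v i = vjoin m (vdrop n v) (vjoin n v bot) i"
    by (auto simp: k_def vjoin_def vdrop_def mc_act_def add.commute)
qed

lemma mc_sum_dim [simp]:
  "dim_row (mc_sum f g) = dim_row f + dim_row g" "dim_col (mc_sum f g) = dim_col f + dim_col g"
  by (auto simp: mc_sum_def)

lemma mc_sum_index:
  "i < dim_row f + dim_row g \<Longrightarrow> j < dim_col f + dim_col g \<Longrightarrow> mc_sum f g $$ (i, j) =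
    (if i < dim_row f then if j < dim_col f then f $$ (i, j) else (0, 0)
     else if j < dim_col f then (0, 0) else g $$ (i - dim_row f, j - dim_col f))"
  by (auto simp: mc_sum_def)

lemma sum_lessThan_add: "(\<Sum>j<m + n. t j) = (\<Sum>j<m. t j) + (\<Sum>j<n. t (m + j))"
  for t :: "nat \<Rightarrow> 'b::comm_monoid_add"
  by (induction n) (simp_all add: add.assoc)

lemma mc_sum_hom:
  assumes "f \<in> mc_hom m n" "g \<in> mc_hom m' n'"
  shows "mc_sum f g \<in> mc_hom (m + m') (n + n')"
proof -
  note F = mc_homD[OF assms(1)] and G = mc_homD[OF assms(2)]
  have "(\<Sum>j<n + n'. fst (mc_sum f g $$ (i, j))) \<le> 1" if "i < m + m'" for i
    using that F G by (cases "i < m") (simp_all add: sum_lessThan_add mc_sum_index)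
  then show ?thesis
    by (intro mc_homI) (auto simp: mc_sum_index F G)
qed

lemma mc_act_sum:
  "mc_act (mc_sum f g) v = vjoin (dim_row f) (mc_act f v) (mc_act g (vdrop (dim_col f) v))"
  by (auto simp: fun_eq_iff mc_act_def vjoin_def vdrop_def mc_sum_index sum_lessThan_add)

section \<open>The trace as a least fixed point\<close>

text \<open>\<open>excursion l n h d\<close> collects the paths of \<open>h\<close> that visit the loop exactly \<open>d\<close> times before
  they exit; its rows below \<open>l\<close> start inside the loop.\<close>

fun excursion :: "nat \<Rightarrow> nat \<Rightarrow> mc_arrow \<Rightarrow> nat \<Rightarrow> mc_arrow" where
  "excursion l n h 0 = mat (dim_row h) n (\<lambda>(i, j). h $$ (i, l + j))"
| "excursion l n h (Suc d) =
    mc_comp (mat (dim_row h) l (\<lambda>(i, j). h $$ (i, j))) (mat l n (\<lambda>(i, j). excursion l n h d $$ (i, j)))"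

section \<open>Excursions as arrows and as Kleene increments\<close>

text \<open>Dropping columns cannot raise a row sum, since the dropped entries are
  nonnegative.\<close>

lemma first_cols_hom:
  assumes "h \<in> mc_hom m (l + n)"
  shows "mat m l (\<lambda>(i, j). h $$ (i, j)) \<in> mc_hom m l"
proof -
  note H = mc_homD[OF assms]
  have "(\<Sum>j<l. fst (h $$ (i, j))) \<le> 1" if "i < m" for i
  proof -
    have "0 \<le> (\<Sum>j<n. fst (h $$ (i, l + j)))"
      using H that by (intro sum_nonneg) auto
    then show ?thesis
      using H(5)[OF that] by (simp add: sum_lessThan_add)
  qed
  then show ?thesis
    by (intro mc_homI) (auto simp: H)
qed

lemma last_cols_hom:
  assumes "h \<in> mc_hom m (l + n)"
  shows "mat m n (\<lambda>(i, j). h $$ (i, l + j)) \<in> mc_hom m n"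
proof -
  note H = mc_homD[OF assms]
  have "(\<Sum>j<n. fst (h $$ (i, l + j))) \<le> 1" if "i < m" for i
  proof -
    have "0 \<le> (\<Sum>j<l. fst (h $$ (i, j)))"
      using H that by (intro sum_nonneg) auto
    then show ?thesis
      using H(5)[OF that] by (simp add: sum_lessThan_add)
  qed
  then show ?thesis
    by (intro mc_homI) (auto simp: H)
qed

lemma first_rows_hom:
  assumes "h \<in> mc_hom (l + m) n"
  shows "mat l n (\<lambda>(i, j). h $$ (i, j)) \<in> mc_hom l n"
  by (rule mc_homI) (auto simp: mc_homD[OF assms])

lemma excursion_hom: "h \<in> mc_hom (l + m) (l + n) \<Longrightarrow> excursion l n h d \<in> mc_hom (l + m) n"
proof (induction d)
  case 0
  then show ?case
    using last_cols_hom[OF 0] by (simp add: mc_homD)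
next
  case (Suc d)
  then show ?case
    using mc_comp_hom[OF first_cols_hom[of h "l + m" l n] first_rows_hom] by (simp add: mc_homD)
qed

text \<open>With the next lemma, excursion \<open>d\<close> is the increment from stage
  \<open>d\<close> to stage \<open>d + 1\<close> of the Kleene iteration of the map taking
  \<open>x\<close> to \<open>mc_act h (vjoin l x y)\<close>. Since \<open>bot\<close> is zero,
  cutting off columns amounts to feeding \<open>bot\<close>.\<close>

lemma mc_act_excursion_0:
  assumes "h \<in> mc_hom (l + m) (l + n)"
  shows "mc_act (excursion l n h 0) y = mc_act h (vjoin l bot y)"
  using mc_homD(1,2)[OF assms]
  by (auto simp: fun_eq_iff mc_act_def sum_lessThan_add vjoin_def bot_val)

lemma mc_act_excursion_Suc:
  assumes h: "h \<in> mc_hom (l + m) (l + n)"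
  shows "mc_act (excursion l n h (Suc d)) y = mc_act h (vjoin l (mc_act (excursion l n h d) y) bot)"
proof -
  note H = mc_homD(1,2)[OF h] and E = mc_homD(1,2)[OF excursion_hom[OF h, of d]]
  have "mc_act (excursion l n h (Suc d)) y =
     mc_act (mat (dim_row h) l (\<lambda>(i, j). h $$ (i, j))) (mc_act (mat l n (\<lambda>(i, j). excursion l n h d $$ (i, j))) y)"
    using mc_act_comp[OF first_cols_hom[OF h] first_rows_hom[OF excursion_hom[OF h, of d]]] by (simp add: H)
  also have "mc_act (mat l n (\<lambda>(i, j). excursion l n h d $$ (i, j))) y =
      vjoin l (mc_act (excursion l n h d) y) bot"
    using E by (auto simp: fun_eq_iff mc_act_def vjoin_def)
  also have "mc_act (mat (dim_row h) l (\<lambda>(i, j). h $$ (i, j))) (vjoin l w bot) = mc_act h (vjoin l w bot)" for w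
    using H by (auto simp: fun_eq_iff mc_act_def sum_lessThan_add vjoin_def bot_val)
  finally show ?thesis .
qed

definition vadd :: "(nat \<Rightarrow> val) \<Rightarrow> (nat \<Rightarrow> val) \<Rightarrow> nat \<Rightarrow> val" where
  "vadd u v = (\<lambda>i. (fst (u i) + fst (v i), snd (u i) + snd (v i)))"

definition vsum :: "nat \<Rightarrow> (nat \<Rightarrow> nat \<Rightarrow> val) \<Rightarrow> nat \<Rightarrow> val" where
  "vsum D s = (\<lambda>i. (\<Sum>d<D. fst (s d i), \<Sum>d<D. snd (s d i)))"

definition vsuminf :: "(nat \<Rightarrow> nat \<Rightarrow> val) \<Rightarrow> nat \<Rightarrow> val" where
  "vsuminf s = (\<lambda>i. (\<Sum>d. fst (s d i), \<Sum>d. snd (s d i)))"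

lemma mc_act_vadd: "mc_act f (vadd u v) = vadd (mc_act f u) (mc_act f v)"
proof
  show "mc_act f (vadd u v) i = vadd (mc_act f u) (mc_act f v) i" for i
    by (simp add: mc_act_def vadd_def bot_val distrib_left sum.distrib ac_simps)
qed

text \<open>The action passes through series without convergence conditions, since every series in
  \<open>ennreal\<close> is summable.\<close>

lemma mc_act_vsuminf: "mc_act f (vsuminf s) = vsuminf (\<lambda>d. mc_act f (s d))"
proof
  show "mc_act f (vsuminf s) i = vsuminf (\<lambda>d. mc_act f (s d)) i" for i
    by (cases "i < dim_row f")
      (simp_all add: mc_act_def vsuminf_def bot_val suminf_sum suminf_add[symmetric])
qed

lemma ennreal_suminf_Suc: "(\<Sum>d. f d) = f 0 + (\<Sum>d. f (Suc d))" for f :: "nat \<Rightarrow> ennreal"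
  using suminf_offset[OF summableI, of f 1] by (simp add: add.commute)

text \<open>Additivity makes the sum of all excursions a fixed point. It is the least one because
  every fixed point bounds the partial sums, which are the Kleene stages.\<close>

lemma lfp_mc_act:
  assumes h: "h \<in> mc_hom (l + m) (l + n)"
  shows "lfp (\<lambda>x. mc_act h (vjoin l x y)) = vsuminf (\<lambda>d. mc_act (excursion l n h d) y)"
proof (rule lfp_eqI)
  let ?s = "\<lambda>d. mc_act (excursion l n h d) y"
  note s0 = mc_act_excursion_0[OF h] and sSuc = mc_act_excursion_Suc[OF h]
  show "mono (\<lambda>x. mc_act h (vjoin l x y))"
    by (auto intro!: monoI monoD[OF mc_act_mono] vjoin_mono)
  \<comment> \<open>Split into the input \<open>y\<close> with an empty loop and the feedback
    without input: the former yields excursion 0, the latter shifts all excursions by one.\<close>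
  have "vjoin l (vsuminf ?s) y = vadd (vjoin l bot y) (vsuminf (\<lambda>d. vjoin l (?s d) bot))"
    by (auto simp: fun_eq_iff vjoin_def vadd_def vsuminf_def bot_val)
  then have "mc_act h (vjoin l (vsuminf ?s) y) = vadd (?s 0) (vsuminf (\<lambda>d. ?s (Suc d)))"
    by (simp only: mc_act_vadd mc_act_vsuminf s0 sSuc)
  also have "\<dots> = vsuminf ?s"
  proof
    fix i
    show "vadd (?s 0) (vsuminf (\<lambda>d. ?s (Suc d))) i = vsuminf ?s i"
      by (simp only: vadd_def vsuminf_def fst_conv snd_conv
          ennreal_suminf_Suc[of "\<lambda>d. fst (?s d i)"] ennreal_suminf_Suc[of "\<lambda>d. snd (?s d i)"])
  qed
  finally show "mc_act h (vjoin l (vsuminf ?s) y) = vsuminf ?s" .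
  fix z assume z: "mc_act h (vjoin l z y) = z"
  have step: "mc_act h (vjoin l (vsum D ?s) y) = vsum (Suc D) ?s" for D
  proof (induction D)
    case 0
    have "vjoin l (vsum 0 ?s) y = vjoin l bot y"
      by (auto simp: vjoin_def vsum_def bot_val)
    then show ?case
      by (simp only: s0[symmetric]) (simp add: vsum_def)
  next
    case (Suc D)
    have "vjoin l (vsum (Suc D) ?s) y = vadd (vjoin l (vsum D ?s) y) (vjoin l (?s D) bot)"
      by (auto simp: fun_eq_iff vjoin_def vadd_def vsum_def bot_val)
    then show ?case
      by (simp only: mc_act_vadd Suc sSuc[symmetric]) (simp add: vsum_def vadd_def)
  qed
  have le: "vsum D ?s \<le> z" for D
  proof (induction D)
    case 0
    show ?case
      by (simp add: vsum_def le_fun_def less_eq_prod_def)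
  next
    case (Suc D)
    then have "mc_act h (vjoin l (vsum D ?s) y) \<le> mc_act h (vjoin l z y)"
      by (intro monoD[OF mc_act_mono] vjoin_mono) auto
    then show ?case
      by (simp only: step z)
  qed
  show "vsuminf ?s \<le> z"
    using le by (auto simp: vsum_def vsuminf_def le_fun_def less_eq_prod_def intro!: suminf_le_const summableI)
qed

section \<open>Finiteness of exit probabilities and rewards\<close>

definition units :: "nat \<Rightarrow> val" where
  "units = (\<lambda>_. (1, 0))"

text \<open>The components at \<open>i\<close> are the probability of ever exiting from
  \<open>i\<close> and the reward accumulated over all paths that do exit.\<close>

definition exit_total :: "nat \<Rightarrow> nat \<Rightarrow> mc_arrow \<Rightarrow> nat \<Rightarrow> val" where
  "exit_total l n h = vsuminf (\<lambda>d. mc_act (excursion l n h d) units)"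

text \<open>Through this, a bound on probabilities or rewards only requires a suitable pre-fixed
  point.\<close>

lemma exit_total_le:
  assumes "h \<in> mc_hom (l + m) (l + n)" "mc_act h (vjoin l w units) \<le> w"
  shows "exit_total l n h \<le> w"
  unfolding exit_total_def lfp_mc_act[OF assms(1), symmetric] using assms(2) by (rule lfp_lowerbound)

lemma exit_total_fixpoint:
  assumes "h \<in> mc_hom (l + m) (l + n)"
  shows "mc_act h (vjoin l (exit_total l n h) units) = exit_total l n h"
  unfolding exit_total_def lfp_mc_act[OF assms, symmetric]
  by (rule lfp_unfold[symmetric]) (auto intro!: monoI monoD[OF mc_act_mono] vjoin_mono)

lemma exit_total_prob_le_1:
  assumes h: "h \<in> mc_hom (l + m) (l + n)"
  shows "fst (exit_total l n h i) \<le> 1"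
proof -
  note H = mc_homD[OF h]
  \<comment> \<open>The value \<open>top\<close> leaves the reward component unconstrained; for
    probabilities, 1 is a pre-fixed point since rows sum to at most 1.\<close>
  let ?w = "\<lambda>_. (1, top) :: val"
  have "mc_act h (vjoin l ?w units) i \<le> (1, top)" for i
  proof (cases "i < l + m")
    case True
    have "(\<Sum>j<l + n. ennreal (fst (h $$ (i, j)))) = ennreal (\<Sum>j<l + n. fst (h $$ (i, j)))"
      using True H(3) by (intro sum_ennreal) auto
    also have "\<dots> \<le> 1"
      using H(5)[OF True] by simp
    moreover have "fst (vjoin l ?w units j) = 1" for j
      by (simp add: vjoin_def units_def)
    ultimately show ?thesis
      using True H(1,2) by (simp add: mc_act_def)
  qed (simp add: mc_act_def H)
  then have "exit_total l n h \<le> ?w"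
    by (intro exit_total_le[OF h]) (simp add: le_fun_def)
  then show ?thesis
    by (simp add: le_fun_def less_eq_prod_def)
qed

text \<open>Finiteness of the rewards rests on the condition that probability 0 forces reward 0,
  which enters here.\<close>

lemma reward_le_prob:
  assumes h: "h \<in> mc_hom m n"
  obtains M where "0 \<le> M" "\<And>i j. i < m \<Longrightarrow> j < n \<Longrightarrow> snd (h $$ (i, j)) \<le> M * fst (h $$ (i, j))"
proof
  note H = mc_homD[OF h]
  \<comment> \<open>At probability 0 the quotient is 0 by convention and so is the reward, hence
    multiplying back is still exact. The sum of all quotients serves as \<open>M\<close>.\<close>
  let ?q = "\<lambda>i j. snd (h $$ (i, j)) / fst (h $$ (i, j))"
  have q: "0 \<le> ?q i j" if "i < m" "j < n" for i j
    using H that by simp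
  show "0 \<le> (\<Sum>i<m. \<Sum>j<n. ?q i j)"
    using q by (intro sum_nonneg) auto
  fix i j assume ij: "i < m" "j < n"
  have "?q i j \<le> (\<Sum>j<n. ?q i j)"
    using q ij by (intro member_le_sum) auto
  also have "\<dots> \<le> (\<Sum>i<m. \<Sum>j<n. ?q i j)"
    using q ij by (intro member_le_sum[of i _ "\<lambda>i. \<Sum>j<n. ?q i j"] sum_nonneg) auto
  finally have "?q i j * fst (h $$ (i, j)) \<le> (\<Sum>i<m. \<Sum>j<n. ?q i j) * fst (h $$ (i, j))"
    using H(3)[OF ij] by (rule mult_right_mono)
  moreover have "?q i j * fst (h $$ (i, j)) = snd (h $$ (i, j))"
    using H(6)[OF ij] by simp
  ultimately show "snd (h $$ (i, j)) \<le> (\<Sum>i<m. \<Sum>j<n. ?q i j) * fst (h $$ (i, j))"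
    by simp
qed

text \<open>Tails of a convergent series drop below half of a positive total; if the total is 0, all
  terms vanish.\<close>

lemma ennreal_tail_le_half:
  fixes f :: "nat \<Rightarrow> ennreal"
  assumes fin: "(\<Sum>d. f d) \<noteq> top"
  shows "\<exists>N. \<forall>n\<ge>N. 2 * (\<Sum>d. f (d + n)) \<le> (\<Sum>d. f d)"
proof (cases "(\<Sum>d. f d) = 0")
  case True
  then have "f d = 0" for d
    by (simp add: suminf_eq_zero_iff summableI)
  then show ?thesis by simp
next
  case False
  define g where "g d = enn2real (f d)" for d
  have fd: "f d \<noteq> top" for d
    using ennreal_suminf_lessD[of f top d] fin by (auto simp: less_top)
  then have f: "f = (\<lambda>d. ennreal (g d))" and g: "\<And>d. 0 \<le> g d"
    by (auto simp: g_def less_top)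
  have sg: "summable g"
    using fin unfolding f by (rule summable_suminf_not_top[OF g])
  have sum_f: "(\<Sum>d. f d) = ennreal (suminf g)"
    unfolding f using g sg by (rule suminf_ennreal2)
  have sgn: "summable (\<lambda>d. g (d + n))" for n
    using sg by (simp add: summable_iff_shift)
  have pos: "0 < suminf g / 2"
    using False suminf_nonneg[OF sg g] unfolding sum_f by (simp add: less_le)
  obtain N where N: "\<And>n. n \<ge> N \<Longrightarrow> norm (\<Sum>d. g (d + n)) < suminf g / 2"
    using suminf_exist_split[OF pos sg] by auto
  have "2 * (\<Sum>d. f (d + n)) \<le> (\<Sum>d. f d)" if "n \<ge> N" for n
  proof -
    have "(\<Sum>d. f (d + n)) = ennreal (\<Sum>d. g (d + n))"
      unfolding f using g sgn by (rule suminf_ennreal2)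
    then have "2 * (\<Sum>d. f (d + n)) = ennreal (2 * (\<Sum>d. g (d + n)))"
      using suminf_nonneg[OF sgn g, of n] by (simp add: ennreal_mult)
    also have "\<dots> \<le> ennreal (suminf g)"
      using N[OF that] by (intro ennreal_leI) simp
    finally show ?thesis
      by (simp only: sum_f)
  qed
  then show ?thesis by blast
qed

text \<open>With \<open>e d i\<close> the probability of exiting from \<open>i\<close> after at least \<open>d\<close> visits to the loop,
  finiteness of the state space gives \<open>N\<close> with \<open>2 * e N \<le> e 0\<close>. If rewards are at most \<open>M\<close> times
  probabilities, then \<open>2 * M * (\<Sum>d<N. e d)\<close> is a finite pre-fixed point for the rewards.\<close>

lemma exit_total_reward_finite:
  assumes h: "h \<in> mc_hom (l + m) (l + n)" and i: "i < l + m"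
  shows "snd (exit_total l n h i) \<noteq> top"
proof -
  note H = mc_homD[OF h]
  let ?p = "\<lambda>i j. ennreal (fst (h $$ (i, j)))" and ?r = "\<lambda>i j. ennreal (snd (h $$ (i, j)))"
  define s where "s d = mc_act (excursion l n h d) units" for d
  define e where "e d i = (\<Sum>d'. fst (s (d' + d) i))" for d i
  have e0: "e 0 i = fst (exit_total l n h i)" for i
    by (simp add: e_def s_def exit_total_def vsuminf_def)
  have e_fin: "e d i \<noteq> top" for d i
  proof -
    have "e 0 i = e d i + (\<Sum>d'<d. fst (s d' i))"
      unfolding e_def using suminf_offset[OF summableI, of "\<lambda>d'. fst (s d' i)" d] by simp
    then have "e d i \<le> e 0 i"
      by simp
    also have "\<dots> \<le> 1"
      using exit_total_prob_le_1[OF h] by (simp add: e0)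
    finally show ?thesis
      by (auto simp: top_unique)
  qed
  \<comment> \<open>An excursion with one more visit starts with a step into the loop, so direct
    exits do not contribute.\<close>
  have eSuc: "e (Suc d) i = (\<Sum>j<l. ?p i j * e d j)" if "i < l + m" for d i
  proof -
    have "fst (s (Suc d') i) = (\<Sum>j<l. ?p i j * fst (s d' j))" for d'
      unfolding s_def mc_act_excursion_Suc[OF h] using that
      by (simp add: mc_act_def H(1,2) sum_lessThan_add vjoin_def bot_val)
    then show ?thesis
      by (simp add: e_def suminf_sum summableI)
  qed
  \<comment> \<open>The first step either enters the loop or exits at once.\<close>
  have e0_rec: "e 0 i = (\<Sum>j<l. ?p i j * e 0 j) + (\<Sum>j<n. ?p i (l + j))" if "i < l + m" for i
  proof -
    have "e 0 i = fst (mc_act h (vjoin l (exit_total l n h) units) i)"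
      by (simp only: exit_total_fixpoint[OF h] e0)
    then show ?thesis
      using that by (simp add: mc_act_def H(1,2) sum_lessThan_add vjoin_def units_def e0)
  qed
  have "\<forall>i. \<exists>N. \<forall>n\<ge>N. 2 * e n i \<le> e 0 i"
    using ennreal_tail_le_half[OF e_fin[of 0, unfolded e_def add_0_right]] by (simp add: e_def)
  then obtain N where N: "\<And>i n. n \<ge> N i \<Longrightarrow> 2 * e n i \<le> e 0 i"
    by metis
  \<comment> \<open>A sum of natural numbers bounds each summand, so \<open>N'\<close> serves all of
    the finitely many states.\<close>
  define N' where "N' = (\<Sum>i<l + m. N i)"
  have half: "2 * e (Suc N') i \<le> e 0 i" if "i < l + m" for i
  proof (rule N)
    have "N i \<le> N'"
      unfolding N'_def using that by (intro member_le_sum) auto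
    then show "N i \<le> Suc N'" by simp
  qed
  obtain M where M: "0 \<le> M" "\<And>i j. i < l + m \<Longrightarrow> j < l + n \<Longrightarrow> snd (h $$ (i, j)) \<le> M * fst (h $$ (i, j))"
    using reward_le_prob[OF h] by metis
  have r: "?r i j \<le> ennreal M * ?p i j" if "i < l + m" "j < l + n" for i j
    using ennreal_leI[OF M(2)[OF that]] M(1) H(3)[OF that] by (simp add: ennreal_mult)
  \<comment> \<open>One step of the loop shifts \<open>e d\<close> to \<open>e (Suc d)\<close>. The
    last shifted term \<open>2 * M * e (Suc N')\<close> is at most \<open>M * e 0\<close>, and the
    rewards of that step add at most another \<open>M * e 0\<close>; together they replace the
    missing term \<open>2 * M * e 0\<close> of \<open>u\<close>.\<close>
  define u where "u i = ennreal M * (2 * (\<Sum>d<Suc N'. e d i))" for i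
  have "mc_act h (vjoin l (\<lambda>i. (e 0 i, u i)) units) i \<le> (e 0 i, u i)" for i
  proof (cases "i < l + m")
    case True
    have "(\<Sum>j<l. ?p i j * u j + ?r i j * e 0 j) + (\<Sum>j<n. ?r i (l + j)) \<le>
      (\<Sum>j<l. ?p i j * u j + ennreal M * ?p i j * e 0 j) + (\<Sum>j<n. ennreal M * ?p i (l + j))"
      using True r by (intro add_mono sum_mono mult_right_mono) auto
    also have "\<dots> = (\<Sum>j<l. ?p i j * u j) + ennreal M * ((\<Sum>j<l. ?p i j * e 0 j) + (\<Sum>j<n. ?p i (l + j)))"
      by (simp only: sum.distrib sum_distrib_left distrib_left mult.assoc add.assoc)
    also have "\<dots> = (\<Sum>j<l. ?p i j * u j) + ennreal M * e 0 i"
      by (simp only: e0_rec[OF True, symmetric])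
    also have "(\<Sum>j<l. ?p i j * u j) = (\<Sum>j<l. \<Sum>d<Suc N'. ennreal M * (2 * (?p i j * e d j)))"
      unfolding u_def sum_distrib_left by (simp only: ac_simps)
    also have "\<dots> = (\<Sum>d<Suc N'. \<Sum>j<l. ennreal M * (2 * (?p i j * e d j)))"
      by (rule sum.swap)
    also have "\<dots> = ennreal M * (2 * (\<Sum>d<Suc N'. e (Suc d) i))"
      by (simp only: eSuc[OF True] sum_distrib_left)
    also have "\<dots> + ennreal M * e 0 i = ennreal M * (2 * (\<Sum>d<N'. e (Suc d) i) + (2 * e (Suc N') i + e 0 i))"
      by (simp add: distrib_left add.assoc)
    also have "\<dots> \<le> ennreal M * (2 * (\<Sum>d<N'. e (Suc d) i) + (e 0 i + e 0 i))"
      using half[OF True] by (intro mult_left_mono add_mono) auto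
    also have "\<dots> = u i"
      unfolding u_def sum.lessThan_Suc_shift distrib_left mult_2 by (simp only: ac_simps)
    finally have "(\<Sum>j<l. ?p i j * u j + ?r i j * e 0 j) + (\<Sum>j<n. ?r i (l + j)) \<le> u i" .
    then show ?thesis
      using True e0_rec[OF True] by (simp add: mc_act_def H(1,2) sum_lessThan_add vjoin_def units_def)
  qed (simp add: mc_act_def H)
  then have "exit_total l n h \<le> (\<lambda>i. (e 0 i, u i))"
    by (intro exit_total_le[OF h]) (simp add: le_fun_def)
  then have "snd (exit_total l n h i) \<le> u i"
    by (simp add: le_fun_def less_eq_prod_def)
  moreover have "u i \<noteq> top"
    by (simp add: u_def ennreal_mult_eq_top_iff e_fin)
  ultimately show ?thesis
    by (auto simp: top_unique)
qed

text \<open>Each entry is at most its row sum, which is what \<open>units\<close> computes, and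
  \<open>exit_total\<close> is finite. So the series in the trace are true sums and not default
  values of \<open>suminf\<close>.\<close>

lemma excursion_summable:
  assumes h: "h \<in> mc_hom (l + m) (l + n)" and ij: "i < l + m" "j < n"
  shows "summable (\<lambda>d. fst (excursion l n h d $$ (i, j)))" (is "summable ?p")
    and "summable (\<lambda>d. snd (excursion l n h d $$ (i, j)))" (is "summable ?r")
proof -
  note E = mc_homD[OF excursion_hom[OF h]]
  let ?s = "\<lambda>d. mc_act (excursion l n h d) units i"
  have le: "ennreal (?p d) \<le> fst (?s d)" "ennreal (?r d) \<le> snd (?s d)" for d
    using ij E(1,2)[of d]
      member_le_sum[of j "{..<n}" "\<lambda>j. ennreal (fst (excursion l n h d $$ (i, j)))"]
      member_le_sum[of j "{..<n}" "\<lambda>j. ennreal (snd (excursion l n h d $$ (i, j)))"]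
    by (simp_all add: mc_act_def units_def)
  have "(\<Sum>d. ennreal (?p d)) \<le> fst (exit_total l n h i)"
    using le by (auto simp: exit_total_def vsuminf_def intro!: suminf_le summableI)
  then have "(\<Sum>d. ennreal (?p d)) \<noteq> top"
    using exit_total_prob_le_1[OF h, of i] by (auto simp: top_unique)
  then show "summable ?p"
    using E(3) ij by (intro summable_suminf_not_top) auto
  have "(\<Sum>d. ennreal (?r d)) \<le> snd (exit_total l n h i)"
    using le by (auto simp: exit_total_def vsuminf_def intro!: suminf_le summableI)
  then have "(\<Sum>d. ennreal (?r d)) \<noteq> top"
    using exit_total_reward_finite[OF h ij(1)] by (auto simp: top_unique)
  then show "summable ?r"
    using E(4) ij by (intro summable_suminf_not_top) auto
qed

section \<open>The block matrix series as a sum of excursions\<close>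

lemma mat_mult_index_sum:
  assumes "A \<in> carrier_mat a b" "B \<in> carrier_mat b c" "i < a" "j < c"
  shows "(A * B) $$ (i, j) = (\<Sum>k<b. A $$ (i, k) * B $$ (k, j))"
  using assms by (simp add: scalar_prod_def atLeast0LessThan)

text \<open>Powers are defined by multiplication on the right, while excursions grow at the front.
  The induction varies \<open>C\<close> to absorb one factor \<open>B\<close>.\<close>

lemma pow_mat_Suc_mult:
  assumes B: "B \<in> carrier_mat N N" and C: "C \<in> carrier_mat N n"
  shows "B ^\<^sub>m Suc d * C = B * (B ^\<^sub>m d * C)"
  using C
proof (induction d arbitrary: C)
  case 0
  then show ?case using B by simp
next
  case (Suc d)
  have Bd: "B ^\<^sub>m k \<in> carrier_mat N N" for k
    using B by simp
  have "B ^\<^sub>m Suc (Suc d) * C = B ^\<^sub>m Suc d * (B * C)"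
    using assoc_mult_mat[OF Bd[of "Suc d"] B Suc.prems] by simp
  also have "\<dots> = B * (B ^\<^sub>m d * (B * C))"
    using Suc.IH[of "B * C"] B Suc.prems by simp
  also have "B ^\<^sub>m d * (B * C) = B ^\<^sub>m Suc d * C"
    using assoc_mult_mat[OF Bd[of d] B Suc.prems] by simp
  finally show ?case .
qed

lemma excursion_Suc_index:
  assumes h: "h \<in> mc_hom (l + m) (l + n)" and ij: "i < l + m" "j < n"
  shows "fst (excursion l n h (Suc d) $$ (i, j)) =
      (\<Sum>k<l. fst (h $$ (i, k)) * fst (excursion l n h d $$ (k, j)))"
    and "snd (excursion l n h (Suc d) $$ (i, j)) =
      (\<Sum>k<l. fst (h $$ (i, k)) * snd (excursion l n h d $$ (k, j))) +
      (\<Sum>k<l. snd (h $$ (i, k)) * fst (excursion l n h d $$ (k, j)))"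
  using ij mc_homD(1,2)[OF h] by (simp_all add: mc_comp_index sum.distrib)

text \<open>The block matrices encode the same \<open>eps\<close> arithmetic: the upper half of
  \<open>B ^\<^sub>m d * C\<close> holds the rewards of excursion \<open>d\<close> from the loop
  states, the lower half their probabilities.\<close>

lemma mc_trace_index:
  assumes h: "h \<in> mc_hom (l + m) (l + n)" and ij: "i < m" "j < n"
  shows "mc_trace l m n h $$ (i, j) =
    (\<Sum>d. fst (excursion l n h d $$ (l + i, j)), \<Sum>d. snd (excursion l n h d $$ (l + i, j)))"
proof -
  note H = mc_homD(1,2)[OF h]
  note E = excursion_Suc_index[OF h]
  define Ap Ar Bp Br Cp Cr where
    "Ap = entry_block l m (prob_mat h)" and "Ar = entry_block l m (rew_mat h)" and
    "Bp = loop_block l (prob_mat h)" and "Br = loop_block l (rew_mat h)" and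
    "Cp = exit_block l n (prob_mat h)" and "Cr = exit_block l n (rew_mat h)"
  define A B C where
    "A = four_block_mat Ap Ar (0\<^sub>m 0 l) (0\<^sub>m 0 l)" and
    "B = four_block_mat Bp Br (0\<^sub>m l l) Bp" and "C = Cr @\<^sub>r Cp"
  note blocks = Ap_def Ar_def Bp_def Br_def Cp_def Cr_def entry_block_def loop_block_def
    exit_block_def prob_mat_def rew_mat_def H
  have car: "Ap \<in> carrier_mat m l" "Ar \<in> carrier_mat m l" "Bp \<in> carrier_mat l l"
    "Br \<in> carrier_mat l l" "Cp \<in> carrier_mat l n" "Cr \<in> carrier_mat l n"
    by (simp_all add: blocks)
  have carA: "A \<in> carrier_mat m (l + l)" and carB: "B \<in> carrier_mat (l + l) (l + l)"
    and carC: "C \<in> carrier_mat (l + l) n"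
    using car by (auto simp: A_def B_def C_def)
  have X: "Bp ^\<^sub>m d * Cp \<in> carrier_mat l n" and Y: "B ^\<^sub>m d * C \<in> carrier_mat (l + l) n" for d
    using car carB carC by (auto intro!: mult_carrier_mat pow_carrier_mat)
  have Xd: "\<forall>k<l. \<forall>j<n. (Bp ^\<^sub>m d * Cp) $$ (k, j) = fst (excursion l n h d $$ (k, j))" for d
  proof (induction d)
    case 0
    then show ?case
      using car by (simp add: blocks)
  next
    case (Suc d)
    show ?case
    proof (intro allI impI)
      fix k j assume kj: "k < l" "j < n"
      have "(Bp ^\<^sub>m Suc d * Cp) $$ (k, j) = (\<Sum>k'<l. Bp $$ (k, k') * (Bp ^\<^sub>m d * Cp) $$ (k', j))"
        unfolding pow_mat_Suc_mult[OF car(3,5)]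
        by (rule mat_mult_index_sum[OF car(3) X kj])
      also have "\<dots> = (\<Sum>k'<l. fst (h $$ (k, k')) * fst (excursion l n h d $$ (k', j)))"
        using Suc kj by (intro sum.cong) (auto simp: blocks)
      finally show "(Bp ^\<^sub>m Suc d * Cp) $$ (k, j) = fst (excursion l n h (Suc d) $$ (k, j))"
        using E(1)[of k j d] kj by simp
    qed
  qed
  have Yd: "\<forall>k<l. \<forall>j<n. (B ^\<^sub>m d * C) $$ (k, j) = snd (excursion l n h d $$ (k, j)) \<and>
      (B ^\<^sub>m d * C) $$ (l + k, j) = fst (excursion l n h d $$ (k, j))" for d
  proof (induction d)
    case 0
    have "(B ^\<^sub>m 0 * C) = C"
      using carB carC by simp
    then show ?case
      using car by (simp add: C_def append_rows_def) (simp add: blocks)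
  next
    case (Suc d)
    show ?case
    proof (intro allI impI)
      fix k j assume kj: "k < l" "j < n"
      have BY: "(B ^\<^sub>m Suc d * C) $$ (k', j) = (\<Sum>q<l. B $$ (k', q) * (B ^\<^sub>m d * C) $$ (q, j)) +
          (\<Sum>q<l. B $$ (k', l + q) * (B ^\<^sub>m d * C) $$ (l + q, j))" if "k' < l + l" for k'
        unfolding pow_mat_Suc_mult[OF carB carC]
        using mat_mult_index_sum[OF carB Y that kj(2)] unfolding sum_lessThan_add .
      have "(B ^\<^sub>m Suc d * C) $$ (k, j) =
          (\<Sum>q<l. fst (h $$ (k, q)) * snd (excursion l n h d $$ (q, j))) +
          (\<Sum>q<l. snd (h $$ (k, q)) * fst (excursion l n h d $$ (q, j)))"
        using Suc kj car by (subst BY) (auto simp: B_def blocks intro!: arg_cong2[of _ _ _ _ "(+)"] sum.cong)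
      moreover have "(B ^\<^sub>m Suc d * C) $$ (l + k, j) =
          (\<Sum>q<l. fst (h $$ (k, q)) * fst (excursion l n h d $$ (q, j)))"
        using Suc kj car by (subst BY) (auto simp: B_def blocks intro!: sum.cong)
      ultimately show "(B ^\<^sub>m Suc d * C) $$ (k, j) = snd (excursion l n h (Suc d) $$ (k, j)) \<and>
          (B ^\<^sub>m Suc d * C) $$ (l + k, j) = fst (excursion l n h (Suc d) $$ (k, j))"
        using E[of k j d] kj by simp
    qed
  qed
  \<comment> \<open>Entering the loop is already the first visit, so \<open>d\<close> inner steps
    belong to excursion \<open>Suc d\<close>.\<close>
  have AX: "(Ap * Bp ^\<^sub>m d * Cp) $$ (i, j) = fst (excursion l n h (Suc d) $$ (l + i, j))" for d
  proof -
    have "Ap * Bp ^\<^sub>m d * Cp = Ap * (Bp ^\<^sub>m d * Cp)"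
      using car by (intro assoc_mult_mat) auto
    then have "(Ap * Bp ^\<^sub>m d * Cp) $$ (i, j) = (\<Sum>k<l. Ap $$ (i, k) * (Bp ^\<^sub>m d * Cp) $$ (k, j))"
      using mat_mult_index_sum[OF car(1) X ij] by simp
    also have "\<dots> = (\<Sum>k<l. fst (h $$ (l + i, k)) * fst (excursion l n h d $$ (k, j)))"
      using Xd[of d] ij by (intro sum.cong) (auto simp: blocks)
    finally show ?thesis
      using E(1)[of "l + i" j d] ij by simp
  qed
  have AY: "(A * B ^\<^sub>m d * C) $$ (i, j) = snd (excursion l n h (Suc d) $$ (l + i, j))" for d
  proof -
    have "A * B ^\<^sub>m d * C = A * (B ^\<^sub>m d * C)"
      using carA carB carC by (intro assoc_mult_mat) auto
    then have "(A * B ^\<^sub>m d * C) $$ (i, j) = (\<Sum>k<l. A $$ (i, k) * (B ^\<^sub>m d * C) $$ (k, j)) +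
        (\<Sum>k<l. A $$ (i, l + k) * (B ^\<^sub>m d * C) $$ (l + k, j))"
      using mat_mult_index_sum[OF carA Y ij] unfolding sum_lessThan_add by (simp only:)
    also have "\<dots> = (\<Sum>k<l. fst (h $$ (l + i, k)) * snd (excursion l n h d $$ (k, j))) +
        (\<Sum>k<l. snd (h $$ (l + i, k)) * fst (excursion l n h d $$ (k, j)))"
      using Yd[of d] ij car
      by (intro arg_cong2[of _ _ _ _ "(+)"] sum.cong) (auto simp: A_def blocks)
    finally show ?thesis
      using E(2)[of "l + i" j d] ij by simp
  qed
  have "mc_trace l m n h $$ (i, j) =
      (prob_mat h $$ (l + i, l + j) + (\<Sum>d. (Ap * Bp ^\<^sub>m d * Cp) $$ (i, j)),
       rew_mat h $$ (l + i, l + j) + (\<Sum>d. (A * B ^\<^sub>m d * C) $$ (i, j)))"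
    using ij unfolding mc_trace_def Let_def A_def B_def C_def Ap_def Ar_def Bp_def Br_def Cp_def Cr_def
    by simp
  also have "prob_mat h $$ (l + i, l + j) = fst (excursion l n h 0 $$ (l + i, j))"
    using ij by (simp add: prob_mat_def H)
  also have "rew_mat h $$ (l + i, l + j) = snd (excursion l n h 0 $$ (l + i, j))"
    using ij by (simp add: rew_mat_def H)
  \<comment> \<open>The direct exit is excursion 0. Putting it in front of the shifted series
    requires summability.\<close>
  finally show ?thesis
    using suminf_split_head[OF excursion_summable(1)[OF h, of "l + i" j]]
      suminf_split_head[OF excursion_summable(2)[OF h, of "l + i" j]] ij
    unfolding AX AY by simp
qed

lemma mc_trace_dim [simp]: "dim_row (mc_trace l m n h) = m" "dim_col (mc_trace l m n h) = n"
  by (simp_all add: mc_trace_def Let_def)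

text \<open>Both sides are the series of excursions, one summed in the reals and one in
  \<open>ennreal\<close>; summability lets \<open>ennreal\<close> pass through the real
  series.\<close>

lemma mc_act_trace:
  assumes h: "h \<in> mc_hom (l + m) (l + n)"
  shows "mc_act (mc_trace l m n h) = ftrace l (mc_act h)"
proof (intro ext)
  fix y i
  note E = mc_homD[OF excursion_hom[OF h]]
  have rhs: "ftrace l (mc_act h) y i = vsuminf (\<lambda>d. mc_act (excursion l n h d) y) (l + i)"
    by (simp only: ftrace_def lfp_mc_act[OF h] vdrop_def)
  show "mc_act (mc_trace l m n h) y i = ftrace l (mc_act h) y i"
  proof (cases "i < m")
    case True
    let ?p = "\<lambda>j d. fst (excursion l n h d $$ (l + i, j))" and ?r = "\<lambda>j d. snd (excursion l n h d $$ (l + i, j))"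
    have p: "ennreal (fst (mc_trace l m n h $$ (i, j))) = (\<Sum>d. ennreal (?p j d))"
      and r: "ennreal (snd (mc_trace l m n h $$ (i, j))) = (\<Sum>d. ennreal (?r j d))" if "j < n" for j
      using that True excursion_summable[OF h, of "l + i" j] E(3,4)
      by (auto simp: mc_trace_index[OF h] intro!: suminf_ennreal2[symmetric])
    have "(\<Sum>d. \<Sum>j<n. ennreal (?p j d) * fst (y j)) = (\<Sum>j<n. (\<Sum>d. ennreal (?p j d)) * fst (y j))"
      by (subst suminf_sum) (simp_all only: summableI ennreal_suminf_multc)
    moreover have "(\<Sum>d. \<Sum>j<n. ennreal (?p j d) * snd (y j) + ennreal (?r j d) * fst (y j)) =
      (\<Sum>j<n. (\<Sum>d. ennreal (?p j d)) * snd (y j) + (\<Sum>d. ennreal (?r j d)) * fst (y j))"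
      by (subst suminf_sum) (simp_all only: summableI ennreal_suminf_multc suminf_add[OF summableI summableI, symmetric])
    ultimately show ?thesis
      unfolding rhs vsuminf_def mc_act_def using True E(1,2) by (simp only: mc_trace_dim if_True) (simp add: p r)
  next
    case False
    then show ?thesis
      unfolding rhs vsuminf_def using E(1) by (simp add: mc_act_def bot_val)
  qed
qed

text \<open>Row sums are exit probabilities, hence at most 1. If a series of nonnegative
  probabilities vanishes, so does each excursion entry, and with it the reward.\<close>

lemma mc_trace_hom:
  assumes h: "h \<in> mc_hom (l + m) (l + n)"
  shows "mc_trace l m n h \<in> mc_hom m n"
proof (rule mc_homI)
  note E = mc_homD[OF excursion_hom[OF h]]
  have nonneg: "0 \<le> fst (mc_trace l m n h $$ (i, j))" "0 \<le> snd (mc_trace l m n h $$ (i, j))"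
    if "i < m" "j < n" for i j
    using that excursion_summable[OF h, of "l + i" j] E(3,4)
    by (auto simp: mc_trace_index[OF h] intro!: suminf_nonneg)
  then show "\<And>i j. i < m \<Longrightarrow> j < n \<Longrightarrow> 0 \<le> fst (mc_trace l m n h $$ (i, j))"
    "\<And>i j. i < m \<Longrightarrow> j < n \<Longrightarrow> 0 \<le> snd (mc_trace l m n h $$ (i, j))"
    by blast+
  fix i assume i: "i < m"
  have "ennreal (\<Sum>j<n. fst (mc_trace l m n h $$ (i, j))) = (\<Sum>j<n. ennreal (fst (mc_trace l m n h $$ (i, j))))"
    using nonneg i by (intro sum_ennreal[symmetric]) auto
  also have "\<dots> = fst (mc_act (mc_trace l m n h) units i)"
    using i by (simp add: mc_act_def units_def)
  also have "\<dots> = fst (exit_total l n h (l + i))"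
    by (simp only: mc_act_trace[OF h] ftrace_def lfp_mc_act[OF h] vdrop_def exit_total_def)
  also have "\<dots> \<le> 1"
    by (rule exit_total_prob_le_1[OF h])
  finally show "(\<Sum>j<n. fst (mc_trace l m n h $$ (i, j))) \<le> 1"
    by simp
  fix j assume j: "j < n" and "fst (mc_trace l m n h $$ (i, j)) = 0"
  then have "\<forall>d. fst (excursion l n h d $$ (l + i, j)) = 0"
    using i E(3) suminf_eq_zero_iff[OF excursion_summable(1)[OF h, of "l + i" j]]
    by (simp add: mc_trace_index[OF h])
  then show "snd (mc_trace l m n h $$ (i, j)) = 0"
    using i j E(6) by (simp add: mc_trace_index[OF h])
qed simp_all

section \<open>The traced categories\<close>

text \<open>By faithfulness, the equational axioms below are checked by computing both actions on an
  arbitrary vector.\<close>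

lemma mc_eqI:
  assumes "f \<in> mc_hom m n" "g \<in> mc_hom m n" "\<And>v. mc_act f v = mc_act g v"
  shows "f = g"
  using mc_act_inj[OF assms(1,2)] assms(3) by blast

lemma vdrop_mc_act_vjoin_bot:
  assumes "dim_row h = l + m"
  shows "vjoin m (vdrop l (mc_act h v)) bot = vdrop l (mc_act h v)"
  using assms by (auto simp: fun_eq_iff vjoin_def vdrop_def mc_act_def)

lemma mc_strict_symmetric_monoidal:
  "strict_symmetric_monoidal_category
    mc_hom mc_id (\<lambda>m l n. mc_comp) (\<lambda>m n m' n'. mc_sum) mc_swap"
proof
  show "mc_id m \<in> mc_hom m m" for m
    by (rule mc_id_hom)
  show "mc_comp f g \<in> mc_hom m n" if "f \<in> mc_hom m l" "g \<in> mc_hom l n" for f g m l n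
    using that by (rule mc_comp_hom)
  show "mc_comp (mc_id m) f = f" if f: "f \<in> mc_hom m n" for f m n
    by (rule mc_eqI[OF mc_comp_hom[OF mc_id_hom f] f])
      (simp add: mc_act_comp[OF mc_id_hom f] mc_act_id mc_homD[OF f])
  show "mc_comp f (mc_id n) = f" if f: "f \<in> mc_hom m n" for f m n
    by (rule mc_eqI[OF mc_comp_hom[OF f mc_id_hom] f])
      (simp add: mc_act_comp[OF f mc_id_hom] mc_act_id mc_homD[OF f])
  show "mc_comp (mc_comp f g) h = mc_comp f (mc_comp g h)"
    if f: "f \<in> mc_hom m k" and g: "g \<in> mc_hom k l" and h: "h \<in> mc_hom l n" for f g h m k l n
    by (rule mc_eqI[OF mc_comp_hom[OF mc_comp_hom[OF f g] h] mc_comp_hom[OF f mc_comp_hom[OF g h]]])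
      (simp only: mc_act_comp[OF mc_comp_hom[OF f g] h] mc_act_comp[OF f mc_comp_hom[OF g h]]
        mc_act_comp[OF f g] mc_act_comp[OF g h])
  show "mc_sum f f' \<in> mc_hom (m + m') (n + n')" if "f \<in> mc_hom m n" "f' \<in> mc_hom m' n'" for f f' m m' n n'
    using that by (rule mc_sum_hom)
  show "mc_sum (mc_id m) (mc_id n) = mc_id (m + n)" for m n
    by (rule mc_eqI[OF mc_sum_hom[OF mc_id_hom mc_id_hom] mc_id_hom])
      (simp add: mc_act_sum mc_act_id vjoin_vjoin_right)
  show "mc_sum (mc_comp f g) (mc_comp f' g') = mc_comp (mc_sum f f') (mc_sum g g')"
    if f: "f \<in> mc_hom m l" and g: "g \<in> mc_hom l n" and f': "f' \<in> mc_hom m' l'" and g': "g' \<in> mc_hom l' n'"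
    for f g f' g' m l n m' l' n'
    by (rule mc_eqI[OF mc_sum_hom[OF mc_comp_hom[OF f g] mc_comp_hom[OF f' g']]
            mc_comp_hom[OF mc_sum_hom[OF f f'] mc_sum_hom[OF g g']]])
      (simp add: mc_act_comp[OF mc_sum_hom[OF f f'] mc_sum_hom[OF g g']] mc_act_comp[OF f g]
        mc_act_comp[OF f' g'] mc_act_sum mc_homD(1,2)[OF f] mc_homD(1,2)[OF g])
  show "mc_sum (mc_sum f f') f'' = mc_sum f (mc_sum f' f'')"
    if f: "f \<in> mc_hom m n" and f': "f' \<in> mc_hom m' n'" and f'': "f'' \<in> mc_hom m'' n''"
    for f f' f'' m n m' n' m'' n''
    by (rule mc_eqI[OF mc_sum_hom[OF mc_sum_hom[OF f f'] f'']
            mc_sum_hom[OF f mc_sum_hom[OF f' f''], folded add.assoc]])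
      (simp add: mc_act_sum vjoin_vjoin_right vdrop_vdrop)
  show "mc_sum (mc_id 0) f = f" if f: "f \<in> mc_hom m n" for f m n
    by (rule mc_eqI[OF mc_sum_hom[OF mc_id_hom f, of 0, unfolded add_0] f]) (simp add: mc_act_sum)
  show "mc_sum f (mc_id 0) = f" if f: "f \<in> mc_hom m n" for f m n
    by (rule mc_eqI[OF mc_sum_hom[OF f mc_id_hom, of 0, unfolded add_0_right] f])
      (simp add: mc_act_sum mc_act_id)
  show "mc_swap m n \<in> mc_hom (m + n) (n + m)" for m n
    by (rule mc_swap_hom)
  show "mc_comp (mc_sum f f') (mc_swap n n') = mc_comp (mc_swap m m') (mc_sum f' f)"
    if f: "f \<in> mc_hom m n" and f': "f' \<in> mc_hom m' n'" for f f' m n m' n'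
    by (rule mc_eqI[OF mc_comp_hom[OF mc_sum_hom[OF f f'] mc_swap_hom]
            mc_comp_hom[OF mc_swap_hom mc_sum_hom[OF f' f]]])
      (simp add: mc_act_comp[OF mc_sum_hom[OF f f'] mc_swap_hom] mc_act_comp[OF mc_swap_hom mc_sum_hom[OF f' f]]
        mc_act_sum mc_act_swap mc_homD(1,2)[OF f] mc_homD(1,2)[OF f'])
  show "mc_comp (mc_swap m n) (mc_swap n m) = mc_id (m + n)" for m n
    by (rule mc_eqI[OF mc_comp_hom[OF mc_swap_hom mc_swap_hom] mc_id_hom])
      (simp add: mc_act_comp[OF mc_swap_hom mc_swap_hom] mc_act_swap mc_act_id, simp add: vjoin_vjoin_right)
  show "mc_swap m (n + k) = mc_comp (mc_sum (mc_swap m n) (mc_id k)) (mc_sum (mc_id n) (mc_swap m k))" for m n k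
  proof -
    \<comment> \<open>Addition on objects is reassociated so that both sides of the hexagon lie in
      one hom-set.\<close>
    have 1: "mc_sum (mc_swap m n) (mc_id k) \<in> mc_hom (m + (n + k)) (n + m + k)"
      using mc_sum_hom[OF mc_swap_hom mc_id_hom, of m n k] by (simp add: add.assoc)
    have 2: "mc_sum (mc_id n) (mc_swap m k) \<in> mc_hom (n + m + k) (n + k + m)"
      using mc_sum_hom[OF mc_id_hom mc_swap_hom, of n m k] by (simp add: add.assoc)
    show ?thesis
    proof (rule mc_eqI[OF mc_swap_hom mc_comp_hom[OF 1 2]])
      fix v :: "nat \<Rightarrow> val"
      \<comment> \<open>The second factor acts first. It exchanges the last two of the blocks of
        \<open>v\<close> with lengths \<open>n\<close>, \<open>k\<close>, \<open>m\<close>.\<close>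
      let ?w = "vjoin n v (vjoin m (vdrop (n + k) v) (vjoin k (vdrop n v) bot))"
      have "mc_act (mc_sum (mc_id n) (mc_swap m k)) v = ?w"
        by (simp add: mc_act_sum mc_act_id mc_act_swap vdrop_vdrop)
      moreover have "vdrop (n + m) ?w = vjoin k (vdrop n v) bot"
        by (simp add: vdrop_vdrop[symmetric])
      moreover have "vjoin (m + n) (vjoin m x (vjoin n v y)) (vjoin k (vdrop n v) bot) = vjoin m x (vjoin (n + k) v bot)" for x y
        by (simp add: vjoin_vjoin_right[symmetric]) (simp add: vjoin_vjoin_right)
      ultimately show "mc_act (mc_swap m (n + k)) v =
          mc_act (mc_comp (mc_sum (mc_swap m n) (mc_id k)) (mc_sum (mc_id n) (mc_swap m k))) v"
        by (simp add: mc_act_comp[OF 1 2] mc_act_sum[of "mc_swap m n"] mc_act_id mc_act_swap)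
    qed
  qed
  show "mc_swap m 0 = mc_id m" for m
    by (rule mc_eqI[OF mc_swap_hom[of m 0, unfolded add_0 add_0_right] mc_id_hom])
      (simp add: mc_act_swap mc_act_id)
qed

text \<open>Each equational axiom becomes the corresponding identity for \<open>ftrace\<close> once
  the action of the arrow under the trace is brought into the matching shape.\<close>

lemma mc_traced:
  "strict_traced_symmetric_monoidal_category
    mc_hom mc_id (\<lambda>m l n. mc_comp) (\<lambda>m n m' n'. mc_sum) mc_swap mc_trace"
proof (intro strict_traced_symmetric_monoidal_category.intro mc_strict_symmetric_monoidal,
    unfold_locales)
  show "mc_trace l m n h \<in> mc_hom m n" if "h \<in> mc_hom (l + m) (l + n)" for l m n h
    using that by (rule mc_trace_hom)
  show "mc_trace l m' n (mc_comp (mc_sum (mc_id l) f) h) = mc_comp f (mc_trace l m n h)"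
    if f: "f \<in> mc_hom m' m" and h: "h \<in> mc_hom (l + m) (l + n)" for f h l m m' n
  proof -
    note k = mc_sum_hom[OF mc_id_hom[of l] f]
    have act: "mc_act (mc_comp (mc_sum (mc_id l) f) h) = (\<lambda>v. vjoin l (mc_act h v) (mc_act f (vdrop l (mc_act h v))))"
      by (rule ext) (simp add: mc_act_comp[OF k h] mc_act_sum mc_act_id)
    show ?thesis
      by (rule mc_eqI[OF mc_trace_hom[OF mc_comp_hom[OF k h]] mc_comp_hom[OF f mc_trace_hom[OF h]]])
        (simp only: mc_act_trace[OF mc_comp_hom[OF k h]] mc_act_comp[OF f mc_trace_hom[OF h]]
          mc_act_trace[OF h] act ftrace_natural_left[OF mc_act_mono mc_act_mono])
  qed
  show "mc_trace l m n' (mc_comp h (mc_sum (mc_id l) g)) = mc_comp (mc_trace l m n h) g"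
    if h: "h \<in> mc_hom (l + m) (l + n)" and g: "g \<in> mc_hom n n'" for h g l m n n'
  proof -
    note k = mc_sum_hom[OF mc_id_hom[of l] g]
    have act: "mc_act (mc_comp h (mc_sum (mc_id l) g)) = (\<lambda>v. mc_act h (vjoin l v (mc_act g (vdrop l v))))"
      by (rule ext) (simp add: mc_act_comp[OF h k] mc_act_sum mc_act_id)
    show ?thesis
      by (rule mc_eqI[OF mc_trace_hom[OF mc_comp_hom[OF h k]] mc_comp_hom[OF mc_trace_hom[OF h] g]])
        (simp only: mc_act_trace[OF mc_comp_hom[OF h k]] mc_act_comp[OF mc_trace_hom[OF h] g]
          mc_act_trace[OF h] act ftrace_natural_right)
  qed
  show "mc_trace l m n (mc_comp h (mc_sum g (mc_id n))) = mc_trace l' m n (mc_comp (mc_sum g (mc_id m)) h)"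
    if h: "h \<in> mc_hom (l + m) (l' + n)" and g: "g \<in> mc_hom l' l" for h g l l' m n
  proof -
    note k = mc_sum_hom[OF g mc_id_hom[of n]] and k' = mc_sum_hom[OF g mc_id_hom[of m]]
    note dims = mc_homD(1,2)[OF h] mc_homD(1,2)[OF g]
    have act: "mc_act (mc_comp h (mc_sum g (mc_id n))) = (\<lambda>v. mc_act h (vjoin l' (mc_act g v) (vdrop l v)))"
      by (rule ext) (simp add: mc_act_comp[OF h k] mc_act_sum mc_act_id dims vjoin_vjoin_right)
    have act': "mc_act (mc_comp (mc_sum g (mc_id m)) h) =
        (\<lambda>v. vjoin l' (mc_act g (mc_act h v)) (vdrop l (mc_act h v)))"
      by (rule ext) (simp add: mc_act_comp[OF k' h] mc_act_sum mc_act_id dims vdrop_mc_act_vjoin_bot)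
    have "ftrace l (\<lambda>v. mc_act h (vjoin l' (mc_act g v) (vdrop l v))) =
        ftrace l' (\<lambda>v. vjoin l' (mc_act g (mc_act h v)) (vdrop l (mc_act h v)))"
      \<comment> \<open>\<open>g\<close> has \<open>l\<close> columns, so its action reads loop
        entries only.\<close>
      by (rule ftrace_dinatural[OF mc_act_mono mc_act_mono]) (simp add: dims)
    then show ?thesis
      by (intro mc_eqI[OF mc_trace_hom[OF mc_comp_hom[OF h k]] mc_trace_hom[OF mc_comp_hom[OF k' h]]])
        (simp only: mc_act_trace[OF mc_comp_hom[OF h k]] mc_act_trace[OF mc_comp_hom[OF k' h]] act act')
  qed
  show "mc_trace 0 m n h = h" if h: "h \<in> mc_hom m n" for h m n
  proof -
    have h': "h \<in> mc_hom (0 + m) (0 + n)"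
      using h by simp
    show ?thesis
      by (rule mc_eqI[OF mc_trace_hom[OF h'] h]) (simp only: mc_act_trace[OF h'] ftrace_0)
  qed
  show "mc_trace (k + l) m n h = mc_trace l m n (mc_trace k (l + m) (l + n) h)"
    if h: "h \<in> mc_hom (k + l + m) (k + l + n)" for h k l m n
  proof -
    have h': "h \<in> mc_hom (k + (l + m)) (k + (l + n))"
      using h by (simp add: add.assoc)
    show ?thesis
      by (rule mc_eqI[OF mc_trace_hom[OF h] mc_trace_hom[OF mc_trace_hom[OF h']]])
        (simp only: mc_act_trace[OF h] mc_act_trace[OF mc_trace_hom[OF h']] mc_act_trace[OF h']
          ftrace_plus[OF mc_act_mono])
  qed
  show "mc_trace l (m + m') (n + n') (mc_sum h g) = mc_sum (mc_trace l m n h) g"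
    if h: "h \<in> mc_hom (l + m) (l + n)" and g: "g \<in> mc_hom m' n'" for h g l m n m' n'
  proof -
    have k: "mc_sum h g \<in> mc_hom (l + (m + m')) (l + (n + n'))"
      using mc_sum_hom[OF h g] by (simp add: add.assoc)
    have act: "mc_act (mc_sum h g) = (\<lambda>v. vjoin (l + m) (mc_act h v) (mc_act g (vdrop (l + n) v)))"
      by (rule ext) (simp add: mc_act_sum mc_homD(1,2)[OF h])
    show ?thesis
      by (rule mc_eqI[OF mc_trace_hom[OF k] mc_sum_hom[OF mc_trace_hom[OF h] g]])
        (simp only: mc_act_trace[OF k] act ftrace_superposing[OF mc_act_mono] mc_act_sum mc_act_trace[OF h] mc_trace_dim)
  qed
  show "mc_trace l l l (mc_swap l l) = mc_id l" for l
  proof -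
    have act: "mc_act (mc_swap l l) = (\<lambda>v. vjoin l (vdrop l v) (vjoin l v bot))"
      by (rule ext) (rule mc_act_swap)
    show ?thesis
      by (rule mc_eqI[OF mc_trace_hom[OF mc_swap_hom] mc_id_hom])
        (simp only: mc_act_trace[OF mc_swap_hom] act ftrace_yanking mc_act_id)
  qed
qed

section \<open>Elementwise lifting to sets of arrows\<close>

text \<open>As unions of singletons the operations nest: composite expressions flatten to iterated
  unions of one singleton.\<close>

lemma mdp_comp_UN: "mdp_comp F G = (\<Union>f\<in>F. \<Union>g\<in>G. {mc_comp f g})"
  and mdp_sum_UN: "mdp_sum F G = (\<Union>f\<in>F. \<Union>g\<in>G. {mc_sum f g})"
  and mdp_trace_UN: "mdp_trace l m n H = (\<Union>h\<in>H. {mc_trace l m n h})"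
  by (auto simp: mdp_comp_def mdp_sum_def mdp_trace_def)

theorem theorem4:
  shows "strict_traced_symmetric_monoidal_category
    mdp_hom mdp_id (\<lambda>m l n. mdp_comp) (\<lambda>m n m' n'. mdp_sum) mdp_swap mdp_trace"
proof -
  interpret mc: strict_traced_symmetric_monoidal_category
    mc_hom mc_id "\<lambda>m l n. mc_comp" "\<lambda>m n m' n'. mc_sum" mc_swap mc_trace
    by (rule mc_traced)
  note defs = mdp_comp_UN mdp_sum_UN mdp_trace_UN mdp_id_def mdp_swap_def
  have hom: "f \<in> mc_hom m n" if "F \<in> mdp_hom m n" "f \<in> F" for f F m n
    using that by (auto simp: mdp_hom_def)
  show ?thesis
    apply unfold_locales
    subgoal by (auto simp: defs mdp_hom_def intro!: mc.Id_hom)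
    subgoal by (auto simp: defs mdp_hom_def intro!: mc.Comp_hom)
    subgoal premises prems
      \<comment> \<open>\<open>SUP_cong\<close> makes membership in the set available, so that the
        law for single arrows rewrites the singleton under the union.\<close>
      using mc.Comp_Id_left[OF hom[OF prems(1)]] by (simp add: defs cong: SUP_cong)
    subgoal premises prems
      using mc.Comp_Id_right[OF hom[OF prems(1)]] by (simp add: defs cong: SUP_cong)
    subgoal premises prems
      using mc.Comp_assoc[OF hom[OF prems(1)] hom[OF prems(2)] hom[OF prems(3)]] by (simp add: defs cong: SUP_cong)
    subgoal by (auto simp: defs mdp_hom_def intro!: mc.Tens_hom)
    subgoal by (simp add: defs mc.Tens_Id)
    subgoal premises prems
      \<comment> \<open>The two sides take the unions in different orders, which
        \<open>blast\<close> reconciles; likewise for naturality of swaps and dinaturality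
        below.\<close>
      using mc.Tens_Comp[OF hom[OF prems(1)] hom[OF prems(2)] hom[OF prems(3)] hom[OF prems(4)]] by (simp add: defs cong: SUP_cong) blast
    subgoal premises prems
      using mc.Tens_assoc[OF hom[OF prems(1)] hom[OF prems(2)] hom[OF prems(3)]] by (simp add: defs cong: SUP_cong)
    subgoal premises prems
      using mc.Tens_unit_left[OF hom[OF prems(1)]] by (simp add: defs cong: SUP_cong)
    subgoal premises prems
      using mc.Tens_unit_right[OF hom[OF prems(1)]] by (simp add: defs cong: SUP_cong)
    subgoal by (auto simp: defs mdp_hom_def intro!: mc.Swap_hom)
    subgoal premises prems
      using mc.Swap_natural[OF hom[OF prems(1)] hom[OF prems(2)]] by (simp add: defs cong: SUP_cong) blast
    subgoal by (simp add: defs mc.Swap_Swap)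
    subgoal by (simp add: defs mc.Swap_hexagon[symmetric])
    subgoal by (simp add: defs mc.Swap_unit)
    subgoal by (auto simp: defs mdp_hom_def intro!: mc.Tr_hom)
    subgoal premises prems
      using mc.Tr_natural_left[OF hom[OF prems(1)] hom[OF prems(2)]] by (simp add: defs cong: SUP_cong)
    subgoal premises prems
      using mc.Tr_natural_right[OF hom[OF prems(1)] hom[OF prems(2)]] by (simp add: defs cong: SUP_cong)
    subgoal premises prems
      using mc.Tr_dinatural[OF hom[OF prems(1)] hom[OF prems(2)]] by (simp add: defs cong: SUP_cong) blast
    subgoal premises prems
      using mc.Tr_vanishing_unit[OF hom[OF prems(1)]] by (simp add: defs cong: SUP_cong)
    subgoal premises prems
      using mc.Tr_vanishing_plus[OF hom[OF prems(1)]] by (simp add: defs cong: SUP_cong)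
    subgoal premises prems
      using mc.Tr_superposing[OF hom[OF prems(1)] hom[OF prems(2)]] by (simp add: defs cong: SUP_cong)
    subgoal by (simp add: defs mc.Tr_yanking)
    done
qed

end
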